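(* Let $A$ be an $H^*$-Galois left $H$-module algebra over a finite dimensional Hopf algebra $H$ and let $E=\operatorname{End}_HA$ with its Hopf algebra structure. Let $R$ and $\widetilde R$ be mutually corresponding quasitriangular structures on $H$ and $E$. Suppose that $A$ is central simple. If $H$ is cocommutative and $R=1\otimes1$, then $\operatorname{rk}\widetilde R=\dim A$.
   Context: $k$ is a field; unadorned $\otimes$, $\operatorname{Hom}$, $\operatorname{End}$ are over $k$. $H$ is a finite dimensional Hopf algebra over $k$ with $\Delta h=\sum_{(h)}h'\otimes h''$, counit $\varepsilon$, antipode $S$. Algebras are extensions of $k$ (so $A\neq0$, $k=k1_A\subset A$). A left $H$-module algebra $A$ is $H^*$-Galois if the map $\pi:A\otimes H\to\operatorname{End}A$, $\pi(a\otimes h)(b)=a(hb)$, is bijective; equivalently (known fact) if any one of the maps $\pi'(a\otimes h)(b)=(hb)a$ from $A\otimes H$ to $\operatorname{End}A$, $\gamma(a\otimes b)(h)=a(hb)$, $\gamma'(a\otimes b)(h)=(ha)b$ from $A\otimes A$ to $\operatorname{Hom}(H,A)\cong A\otimes H^*$ is bijective. Then $\dim A<\infty$ and $A^H=k$. $E=\operatorname{End}_HA$ acts on $A$ from the left and carries the unique Hopf algebra structure making $A$ a left $E$-module algebra: $\varphi(ab)=\sum_{(\varphi)}\varphi'(a)\varphi''(b)$, $\varepsilon(\varphi)=\varphi(1)$. A quasitriangular structure on a Hopf algebra $H$ is an element $R=\sum_ir'_i\otimes r''_i\in H\otimes H$ with $\Delta^{\mathrm{op}}(h)R=R\Delta(h)$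 for all $h\in H$, $(\varepsilon\otimes\operatorname{id})(R)=1=(\operatorname{id}\otimes\varepsilon)(R)$, $(\Delta\otimes\operatorname{id})(R)=R_{13}R_{23}$, $(\operatorname{id}\otimes\Delta)(R)=R_{13}R_{12}$. Its rank is $\operatorname{rk}R=\dim R_l=\dim R_r$, where $R_r\subset H$ is the image of $H^*\to H$, $\xi\mapsto\sum_i\langle\xi,r'_i\rangle r''_i$, and $R_l\subset H$ is the image of $\xi\mapsto\sum_i\langle\xi,r''_i\rangle r'_i$. There is a bijective correspondence between quasitriangular structures on $H$ and on $E$ under which $R=\sum_ir'_i\otimes r''_i$ and $\widetilde R=\sum_m\rho'_m\otimes\rho''_m$ correspond to one another if and only if $\sum_i(r''_ib)(r'_ia)=\sum_m(\rho''_ma)(\rho'_mb)$ for all $a,b\in A$. *)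

theory Defs
  imports Complex_Main "HOL-Library.Function_Algebras"
begin

section \<open>Linear and bilinear maps on subspaces\<close>

text \<open>A vector space over the field \<^typ>\<open>'k\<close> is given by a scalar multiplication \<open>s\<close> on an
  ambient type together with a subspace \<open>V\<close>. Working with subspaces is what allows the
  set of \<open>H\<close>-linear endomorphisms of \<open>A\<close> to be a Hopf algebra in its own right.\<close>

definition linear_on ::
  "('k::field \<Rightarrow> 'v::ab_group_add \<Rightarrow> 'v) \<Rightarrow> 'v set \<Rightarrow> ('k \<Rightarrow> 'u::ab_group_add \<Rightarrow> 'u) \<Rightarrow> ('v \<Rightarrow> 'u) \<Rightarrow> bool"
  where "linear_on s V t f \<longleftrightarrow>
    (\<forall>x\<in>V. \<forall>y\<in>V. f (x + y) = f x + f y) \<and> (\<forall>c. \<forall>x\<in>V. f (s c x) = t c (f x))"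

definition bilinear_on ::
  "('k::field \<Rightarrow> 'v::ab_group_add \<Rightarrow> 'v) \<Rightarrow> 'v set \<Rightarrow> ('k \<Rightarrow> 'w::ab_group_add \<Rightarrow> 'w) \<Rightarrow> 'w set \<Rightarrow>
   ('k \<Rightarrow> 'u::ab_group_add \<Rightarrow> 'u) \<Rightarrow> ('v \<Rightarrow> 'w \<Rightarrow> 'u) \<Rightarrow> bool"
  where "bilinear_on sV V sW W t g \<longleftrightarrow>
    (\<forall>w\<in>W. linear_on sV V t (\<lambda>v. g v w)) \<and> (\<forall>v\<in>V. linear_on sW W t (g v))"

definition finite_dim_on :: "('k::field \<Rightarrow> 'v::ab_group_add \<Rightarrow> 'v) \<Rightarrow> 'v set \<Rightarrow> bool"
  where "finite_dim_on s V \<longleftrightarrow> (\<exists>B. finite B \<and> module.span s B = V)"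

definition fun_scale :: "('k \<Rightarrow> 'u \<Rightarrow> 'u) \<Rightarrow> 'k \<Rightarrow> ('x \<Rightarrow> 'u) \<Rightarrow> ('x \<Rightarrow> 'u)"
  where "fun_scale s c f = (\<lambda>x. s c (f x))"

definition End :: "('k::field \<Rightarrow> 'a::ab_group_add \<Rightarrow> 'a) \<Rightarrow> ('a \<Rightarrow> 'a) set"
  where "End s = {f. Vector_Spaces.linear s s f}"


section \<open>Tensor products\<close>

text \<open>Over a field, \<open>V \<otimes> W\<close> embeds into the dual of the space of bilinear forms
  on \<open>V \<times> W\<close> by letting \<open>v \<otimes> w\<close> be evaluation at \<open>(v, w)\<close>; \<open>V \<otimes> W\<close> is realised as the set
  of finite sums of these evaluations. The universal property is proved below
  (\<open>tlift_sum\<close>, \<open>bilinear_tpure\<close>).\<close>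

type_synonym ('k, 'v, 'w) tensor = "('v \<Rightarrow> 'w \<Rightarrow> 'k) \<Rightarrow> 'k"

abbreviation tscale :: "'k::field \<Rightarrow> ('k, 'v, 'w) tensor \<Rightarrow> ('k, 'v, 'w) tensor"
  where "tscale \<equiv> fun_scale (*)"

definition tpure ::
  "('k::field \<Rightarrow> 'v::ab_group_add \<Rightarrow> 'v) \<Rightarrow> 'v set \<Rightarrow> ('k \<Rightarrow> 'w::ab_group_add \<Rightarrow> 'w) \<Rightarrow> 'w set \<Rightarrow>
   'v \<Rightarrow> 'w \<Rightarrow> ('k, 'v, 'w) tensor"
  where "tpure sV V sW W v w = (\<lambda>B. if bilinear_on sV V sW W (*) B then B v w else 0)"

definition tspace ::
  "('k::field \<Rightarrow> 'v::ab_group_add \<Rightarrow> 'v) \<Rightarrow> 'v set \<Rightarrow> ('k \<Rightarrow> 'w::ab_group_add \<Rightarrow> 'w) \<Rightarrow> 'w set \<Rightarrow>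
   ('k, 'v, 'w) tensor set"
  where "tspace sV V sW W = {\<Sum>(v, w)\<leftarrow>xs. tpure sV V sW W v w | xs. set xs \<subseteq> V \<times> W}"

text \<open>\<open>tlift sV V sW W g t\<close> is \<open>\<Sum>\<^sub>i g v\<^sub>i w\<^sub>i\<close> for \<open>t = \<Sum>\<^sub>i v\<^sub>i \<otimes> w\<^sub>i\<close>; it does not depend on the chosen
  expression of \<open>t\<close> when \<open>g\<close> is bilinear.\<close>

definition tlift ::
  "('k::field \<Rightarrow> 'v::ab_group_add \<Rightarrow> 'v) \<Rightarrow> 'v set \<Rightarrow> ('k \<Rightarrow> 'w::ab_group_add \<Rightarrow> 'w) \<Rightarrow> 'w set \<Rightarrow>
   ('v \<Rightarrow> 'w \<Rightarrow> 'u::ab_group_add) \<Rightarrow> ('k, 'v, 'w) tensor \<Rightarrow> 'u"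
  where "tlift sV V sW W g t = (SOME u. \<exists>xs. set xs \<subseteq> V \<times> W \<and>
    t = (\<Sum>(v, w)\<leftarrow>xs. tpure sV V sW W v w) \<and> u = (\<Sum>(v, w)\<leftarrow>xs. g v w))"

lemma vector_space_field: "vector_space ((*) :: 'k::field \<Rightarrow> 'k \<Rightarrow> 'k)"
  by unfold_locales (auto simp: algebra_simps)

lemma vector_space_fun_scale:
  assumes "vector_space s" shows "vector_space (fun_scale s)"
proof -
  interpret vector_space s by fact
  show ?thesis
    by unfold_locales
      (auto simp: fun_scale_def fun_eq_iff scale_right_distrib scale_left_distrib)
qed

lemma bilinear_tpure: "bilinear_on sV V sW W tscale (tpure sV V sW W)"
  unfolding bilinear_on_def linear_on_def tpure_def
  by (auto simp: fun_eq_iff fun_scale_def bilinear_on_def linear_on_def)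

lemma eval_tensor:
  assumes "bilinear_on sV V sW W (*) B"
  shows "(\<Sum>(v, w)\<leftarrow>xs. tpure sV V sW W v w) B = (\<Sum>(v, w)\<leftarrow>xs. B v w)"
  using assms by (induction xs) (auto simp: tpure_def)

lemma tlift_unique:
  assumes "vector_space sU" and g: "bilinear_on sV V sW W sU g"
    and eq: "(\<Sum>(v, w)\<leftarrow>xs. tpure sV V sW W v w) = (\<Sum>(v, w)\<leftarrow>ys. tpure sV V sW W v w)"
  shows "(\<Sum>(v, w)\<leftarrow>xs. g v w) = (\<Sum>(v, w)\<leftarrow>ys. g v w)"
proof (rule ccontr)
  assume ne: "\<not> ?thesis"
  define u where "u = (\<Sum>(v, w)\<leftarrow>xs. g v w) - (\<Sum>(v, w)\<leftarrow>ys. g v w)"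
  from ne have u: "u \<noteq> 0" by (simp add: u_def)
  interpret U: vector_space sU by fact
  interpret K: vector_space "(*) :: 'a \<Rightarrow> 'a \<Rightarrow> 'a" by (rule vector_space_field)
  interpret P: vector_space_pair sU "(*) :: 'a \<Rightarrow> 'a \<Rightarrow> 'a" ..
  have "U.independent {u}" using u by simp
  from P.linear_independent_extend[OF this, of "\<lambda>_. 1"] obtain \<xi>
    where \<xi>: "Vector_Spaces.linear sU (*) \<xi>" "\<xi> u = 1" by auto
  interpret X: Vector_Spaces.linear sU "(*)" \<xi> by fact
  have B: "bilinear_on sV V sW W (*) (\<lambda>v w. \<xi> (g v w))"
    using g unfolding bilinear_on_def linear_on_def by (auto simp: X.add X.scale)
  have sum: "(\<Sum>(v, w)\<leftarrow>zs. \<xi> (g v w)) = \<xi> (\<Sum>(v, w)\<leftarrow>zs. g v w)" for zs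
    by (induction zs) (auto simp: X.add)
  have "\<xi> (\<Sum>(v, w)\<leftarrow>xs. g v w) = \<xi> (\<Sum>(v, w)\<leftarrow>ys. g v w)"
    using arg_cong[OF eq, of "\<lambda>t. t (\<lambda>v w. \<xi> (g v w))"] by (simp add: eval_tensor[OF B] sum)
  hence "\<xi> u = 0" by (simp add: u_def X.diff)
  with \<xi> show False by simp
qed

theorem tlift_sum:
  assumes "vector_space sU" "bilinear_on sV V sW W sU g" "set xs \<subseteq> V \<times> W"
  shows "tlift sV V sW W g (\<Sum>(v, w)\<leftarrow>xs. tpure sV V sW W v w) = (\<Sum>(v, w)\<leftarrow>xs. g v w)"
proof -
  have "\<exists>u ys. set ys \<subseteq> V \<times> W \<and>
    (\<Sum>(v, w)\<leftarrow>xs. tpure sV V sW W v w) = (\<Sum>(v, w)\<leftarrow>ys. tpure sV V sW W v w) \<and>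
    u = (\<Sum>(v, w)\<leftarrow>ys. g v w)"
    using assms(3) by blast
  from someI_ex[OF this] obtain ys where ys:
    "(\<Sum>(v, w)\<leftarrow>xs. tpure sV V sW W v w) = (\<Sum>(v, w)\<leftarrow>ys. tpure sV V sW W v w)"
    "tlift sV V sW W g (\<Sum>(v, w)\<leftarrow>xs. tpure sV V sW W v w) = (\<Sum>(v, w)\<leftarrow>ys. g v w)"
    unfolding tlift_def[symmetric] by (elim exE conjE)
  show ?thesis
    unfolding ys(2) by (rule tlift_unique[OF assms(1,2) ys(1), symmetric])
qed

corollary tlift_sum_set:
  fixes sV :: "'k::field \<Rightarrow> 'v::ab_group_add \<Rightarrow> 'v" and sW :: "'k \<Rightarrow> 'w::ab_group_add \<Rightarrow> 'w"
  assumes "vector_space sU" "bilinear_on sV V sW W sU g" "finite I"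
    "\<And>i. i \<in> I \<Longrightarrow> v i \<in> V" "\<And>i. i \<in> I \<Longrightarrow> w i \<in> W"
  shows "tlift sV V sW W g (\<Sum>i\<in>I. tpure sV V sW W (v i) (w i)) = (\<Sum>i\<in>I. g (v i) (w i))"
proof -
  obtain ns where ns: "set ns = I" "distinct ns"
    using finite_distinct_list[OF assms(3)] by blast
  have conv: "(\<Sum>i\<in>I. f (v i) (w i)) = (\<Sum>(x, y)\<leftarrow>map (\<lambda>i. (v i, w i)) ns. f x y)"
    for f :: "'v \<Rightarrow> 'w \<Rightarrow> 'x::comm_monoid_add"
    using ns by (simp add: o_def sum_list_distinct_conv_sum_set)
  show ?thesis
    unfolding conv by (rule tlift_sum[OF assms(1,2)]) (use assms(4,5) ns in auto)
qed

definition tswap ::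
  "('k::field \<Rightarrow> 'v::ab_group_add \<Rightarrow> 'v) \<Rightarrow> 'v set \<Rightarrow> ('k, 'v, 'v) tensor \<Rightarrow> ('k, 'v, 'v) tensor"
  where "tswap s V = tlift s V s V (\<lambda>x y. tpure s V s V y x)"

definition tmult ::
  "('k::field \<Rightarrow> 'v::ab_group_add \<Rightarrow> 'v) \<Rightarrow> 'v set \<Rightarrow> ('v \<Rightarrow> 'v \<Rightarrow> 'v) \<Rightarrow>
   ('k \<Rightarrow> 'w::ab_group_add \<Rightarrow> 'w) \<Rightarrow> 'w set \<Rightarrow> ('w \<Rightarrow> 'w \<Rightarrow> 'w) \<Rightarrow>
   ('k, 'v, 'w) tensor \<Rightarrow> ('k, 'v, 'w) tensor \<Rightarrow> ('k, 'v, 'w) tensor"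
  where "tmult sV V mV sW W mW t u =
    tlift sV V sW W (\<lambda>a b. tlift sV V sW W (\<lambda>c d. tpure sV V sW W (mV a c) (mW b d)) u) t"

abbreviation tmult2 ::
  "('k::field \<Rightarrow> 'v::ab_group_add \<Rightarrow> 'v) \<Rightarrow> 'v set \<Rightarrow> ('v \<Rightarrow> 'v \<Rightarrow> 'v) \<Rightarrow>
   ('k, 'v, 'v) tensor \<Rightarrow> ('k, 'v, 'v) tensor \<Rightarrow> ('k, 'v, 'v) tensor"
  where "tmult2 s V m \<equiv> tmult s V m s V m"

text \<open>\<open>V \<otimes> V \<otimes> V\<close> is \<open>(V \<otimes> V) \<otimes> V\<close>.\<close>

definition tpure3 ::
  "('k::field \<Rightarrow> 'v::ab_group_add \<Rightarrow> 'v) \<Rightarrow> 'v set \<Rightarrow> 'v \<Rightarrow> 'v \<Rightarrow> 'v \<Rightarrow> ('k, ('k, 'v, 'v) tensor, 'v) tensor"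
  where "tpure3 s V x y z = tpure tscale (tspace s V s V) s V (tpure s V s V x y) z"

definition tmult3 ::
  "('k::field \<Rightarrow> 'v::ab_group_add \<Rightarrow> 'v) \<Rightarrow> 'v set \<Rightarrow> ('v \<Rightarrow> 'v \<Rightarrow> 'v) \<Rightarrow>
   ('k, ('k, 'v, 'v) tensor, 'v) tensor \<Rightarrow> ('k, ('k, 'v, 'v) tensor, 'v) tensor \<Rightarrow>
   ('k, ('k, 'v, 'v) tensor, 'v) tensor"
  where "tmult3 s V m = tmult tscale (tspace s V s V) (tmult2 s V m) s V m"

text \<open>The maps \<open>\<Delta> \<otimes> id\<close> and \<open>id \<otimes> \<Delta>\<close> from \<open>V \<otimes> V\<close> to \<open>V \<otimes> V \<otimes> V\<close>.\<close>

definition comul_id ::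
  "('k::field \<Rightarrow> 'v::ab_group_add \<Rightarrow> 'v) \<Rightarrow> 'v set \<Rightarrow> ('v \<Rightarrow> ('k, 'v, 'v) tensor) \<Rightarrow>
   ('k, 'v, 'v) tensor \<Rightarrow> ('k, ('k, 'v, 'v) tensor, 'v) tensor"
  where "comul_id s V \<Delta> =
    tlift s V s V (\<lambda>x y. tlift s V s V (\<lambda>u v. tpure3 s V u v y) (\<Delta> x))"

definition id_comul ::
  "('k::field \<Rightarrow> 'v::ab_group_add \<Rightarrow> 'v) \<Rightarrow> 'v set \<Rightarrow> ('v \<Rightarrow> ('k, 'v, 'v) tensor) \<Rightarrow>
   ('k, 'v, 'v) tensor \<Rightarrow> ('k, ('k, 'v, 'v) tensor, 'v) tensor"
  where "id_comul s V \<Delta> =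
    tlift s V s V (\<lambda>x y. tlift s V s V (\<lambda>u v. tpure3 s V x u v) (\<Delta> y))"


section \<open>Algebras, Hopf algebras, module algebras\<close>

locale algebra_on = vector_space s
  for s :: "'k::field \<Rightarrow> 'v::ab_group_add \<Rightarrow> 'v" +
  fixes C :: "'v set" and mult :: "'v \<Rightarrow> 'v \<Rightarrow> 'v" and unit :: 'v
  assumes subspace_C: "subspace C"
    and mult_closed: "\<And>x y. x \<in> C \<Longrightarrow> y \<in> C \<Longrightarrow> mult x y \<in> C"
    and mult_bilinear: "bilinear_on s C s C s mult"
    and mult_assoc: "\<And>x y z. x \<in> C \<Longrightarrow> y \<in> C \<Longrightarrow> z \<in> C \<Longrightarrow> mult (mult x y) z = mult x (mult y z)"
    and unit_closed: "unit \<in> C"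
    and unit_left: "\<And>x. x \<in> C \<Longrightarrow> mult unit x = x"
    and unit_right: "\<And>x. x \<in> C \<Longrightarrow> mult x unit = x"
    and unit_nonzero: "unit \<noteq> 0"

locale hopf_algebra_on = algebra_on s C mult unit
  for s :: "'k::field \<Rightarrow> 'v::ab_group_add \<Rightarrow> 'v" and C :: "'v set"
    and mult :: "'v \<Rightarrow> 'v \<Rightarrow> 'v" and unit :: 'v +
  fixes \<Delta> :: "'v \<Rightarrow> ('k, 'v, 'v) tensor" and \<epsilon> :: "'v \<Rightarrow> 'k" and S :: "'v \<Rightarrow> 'v"
  assumes comul_closed: "\<And>x. x \<in> C \<Longrightarrow> \<Delta> x \<in> tspace s C s C"
    and comul_linear: "linear_on s C tscale \<Delta>"
    and counit_linear: "linear_on s C (*) \<epsilon>"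
    and coassoc: "\<And>x. x \<in> C \<Longrightarrow> comul_id s C \<Delta> (\<Delta> x) = id_comul s C \<Delta> (\<Delta> x)"
    and counit_left: "\<And>x. x \<in> C \<Longrightarrow> tlift s C s C (\<lambda>u v. s (\<epsilon> u) v) (\<Delta> x) = x"
    and counit_right: "\<And>x. x \<in> C \<Longrightarrow> tlift s C s C (\<lambda>u v. s (\<epsilon> v) u) (\<Delta> x) = x"
    and comul_mult: "\<And>x y. x \<in> C \<Longrightarrow> y \<in> C \<Longrightarrow> \<Delta> (mult x y) = tmult2 s C mult (\<Delta> x) (\<Delta> y)"
    and comul_unit: "\<Delta> unit = tpure s C s C unit unit"
    and counit_mult: "\<And>x y. x \<in> C \<Longrightarrow> y \<in> C \<Longrightarrow> \<epsilon> (mult x y) = \<epsilon> x * \<epsilon> y"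
    and counit_unit: "\<epsilon> unit = 1"
    and antipode_closed: "\<And>x. x \<in> C \<Longrightarrow> S x \<in> C"
    and antipode_linear: "linear_on s C s S"
    and antipode_left:
      "\<And>x. x \<in> C \<Longrightarrow> tlift s C s C (\<lambda>u v. mult (S u) v) (\<Delta> x) = s (\<epsilon> x) unit"
    and antipode_right:
      "\<And>x. x \<in> C \<Longrightarrow> tlift s C s C (\<lambda>u v. mult u (S v)) (\<Delta> x) = s (\<epsilon> x) unit"

definition cocommutative ::
  "('k::field \<Rightarrow> 'v::ab_group_add \<Rightarrow> 'v) \<Rightarrow> 'v set \<Rightarrow> ('v \<Rightarrow> ('k, 'v, 'v) tensor) \<Rightarrow> bool"
  where "cocommutative s C \<Delta> \<longleftrightarrow> (\<forall>x\<in>C. tswap s C (\<Delta> x) = \<Delta> x)"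

locale module_algebra =
  H: hopf_algebra_on s C mult unit \<Delta> \<epsilon> S + A: algebra_on sA UNIV "(*)" 1
  for s :: "'k::field \<Rightarrow> 'v::ab_group_add \<Rightarrow> 'v" and C :: "'v set"
    and mult :: "'v \<Rightarrow> 'v \<Rightarrow> 'v" and unit :: 'v
    and \<Delta> :: "'v \<Rightarrow> ('k, 'v, 'v) tensor" and \<epsilon> :: "'v \<Rightarrow> 'k" and S :: "'v \<Rightarrow> 'v"
    and sA :: "'k \<Rightarrow> 'a::ring_1 \<Rightarrow> 'a" +
  fixes act :: "'v \<Rightarrow> 'a \<Rightarrow> 'a"
  assumes act_bilinear: "bilinear_on s C sA UNIV sA act"
    and act_unit: "\<And>a. act unit a = a"
    and act_mult: "\<And>x y a. x \<in> C \<Longrightarrow> y \<in> C \<Longrightarrow> act (mult x y) a = act x (act y a)"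
    and act_prod: "\<And>x a b. x \<in> C \<Longrightarrow>
      act x (a * b) = tlift s C s C (\<lambda>u v. act u a * act v b) (\<Delta> x)"
    and act_one: "\<And>x. x \<in> C \<Longrightarrow> act x 1 = sA (\<epsilon> x) 1"

definition galois ::
  "('k::field \<Rightarrow> 'v::ab_group_add \<Rightarrow> 'v) \<Rightarrow> 'v set \<Rightarrow> ('k \<Rightarrow> 'a::ring_1 \<Rightarrow> 'a) \<Rightarrow> ('v \<Rightarrow> 'a \<Rightarrow> 'a) \<Rightarrow> bool"
  where "galois s C sA act \<longleftrightarrow>
    bij_betw (tlift sA UNIV s C (\<lambda>a h b. a * act h b)) (tspace sA UNIV s C) (End sA)"

definition End_H ::
  "'v set \<Rightarrow> ('k::field \<Rightarrow> 'a::ring_1 \<Rightarrow> 'a) \<Rightarrow> ('v \<Rightarrow> 'a \<Rightarrow> 'a) \<Rightarrow> ('a \<Rightarrow> 'a) set"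
  where "End_H C sA act = {f \<in> End sA. \<forall>h\<in>C. \<forall>a. f (act h a) = act h (f a)}"

definition two_sided_ideal :: "'a::ring_1 set \<Rightarrow> bool"
  where "two_sided_ideal I \<longleftrightarrow> 0 \<in> I \<and> (\<forall>x\<in>I. \<forall>y\<in>I. x + y \<in> I) \<and>
    (\<forall>x\<in>I. \<forall>a. a * x \<in> I \<and> x * a \<in> I)"

definition central_simple :: "('k::field \<Rightarrow> 'a::ring_1 \<Rightarrow> 'a) \<Rightarrow> bool"
  where "central_simple sA \<longleftrightarrow>
    {z. \<forall>a. z * a = a * z} = range (\<lambda>c. sA c 1) \<and>
    (\<forall>I :: 'a set. two_sided_ideal I \<longrightarrow> I = {0} \<or> I = UNIV)"


section \<open>Quasitriangular structures\<close>

definition quasitriangular ::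
  "('k::field \<Rightarrow> 'v::ab_group_add \<Rightarrow> 'v) \<Rightarrow> 'v set \<Rightarrow> ('v \<Rightarrow> 'v \<Rightarrow> 'v) \<Rightarrow> 'v \<Rightarrow>
   ('v \<Rightarrow> ('k, 'v, 'v) tensor) \<Rightarrow> ('v \<Rightarrow> 'k) \<Rightarrow> ('k, 'v, 'v) tensor \<Rightarrow> bool"
  where "quasitriangular s C mult unit \<Delta> \<epsilon> R \<longleftrightarrow>
    (let R12 = tlift s C s C (\<lambda>x y. tpure3 s C x y unit) R;
         R13 = tlift s C s C (\<lambda>x y. tpure3 s C x unit y) R;
         R23 = tlift s C s C (\<lambda>x y. tpure3 s C unit x y) R
     in R \<in> tspace s C s C \<and>
        (\<forall>h\<in>C. tmult2 s C mult (tswap s C (\<Delta> h)) R = tmult2 s C mult R (\<Delta> h)) \<and>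
        tlift s C s C (\<lambda>x y. s (\<epsilon> x) y) R = unit \<and>
        tlift s C s C (\<lambda>x y. s (\<epsilon> y) x) R = unit \<and>
        comul_id s C \<Delta> R = tmult3 s C mult R13 R23 \<and>
        id_comul s C \<Delta> R = tmult3 s C mult R13 R12)"

definition R_right ::
  "('k::field \<Rightarrow> 'v::ab_group_add \<Rightarrow> 'v) \<Rightarrow> 'v set \<Rightarrow> ('k, 'v, 'v) tensor \<Rightarrow> 'v set"
  where "R_right s C R = {tlift s C s C (\<lambda>x y. s (\<xi> x) y) R | \<xi>. linear_on s C (*) \<xi>}"

definition R_left ::
  "('k::field \<Rightarrow> 'v::ab_group_add \<Rightarrow> 'v) \<Rightarrow> 'v set \<Rightarrow> ('k, 'v, 'v) tensor \<Rightarrow> 'v set"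
  where "R_left s C R = {tlift s C s C (\<lambda>x y. s (\<xi> y) x) R | \<xi>. linear_on s C (*) \<xi>}"

text \<open>The rank is the dimension of \<open>R_left\<close>, which is also that of \<open>R_right\<close>
  (\<open>rank_eq_dim_R_right\<close>).\<close>

definition qt_rank ::
  "('k::field \<Rightarrow> 'v::ab_group_add \<Rightarrow> 'v) \<Rightarrow> 'v set \<Rightarrow> ('k, 'v, 'v) tensor \<Rightarrow> nat"
  where "qt_rank s C R = vector_space.dim s (R_left s C R)"

context
  fixes s :: "'k::field \<Rightarrow> 'v::ab_group_add \<Rightarrow> 'v" and C :: "'v set" and R :: "('k, 'v, 'v) tensor"
  assumes vs: "vector_space s" and sub: "module.subspace s C" and R: "R \<in> tspace s C s C"
begin

interpretation vector_space s by (rule vs)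
interpretation T: vector_space "tscale :: 'k \<Rightarrow> ('k, 'v, 'v) tensor \<Rightarrow> _"
  by (intro vector_space_fun_scale vector_space_field)
interpretation K: vector_space_pair s "(*) :: 'k \<Rightarrow> 'k \<Rightarrow> 'k"
  by (intro vector_space_pair.intro vs vector_space_field)

private abbreviation (input) tens (infix "\<otimes>" 75) where "x \<otimes> y \<equiv> tpure s C s C x y"

private definition rep :: "nat set \<Rightarrow> (nat \<Rightarrow> 'v) \<Rightarrow> (nat \<Rightarrow> 'v) \<Rightarrow> bool"
  where "rep I v w \<longleftrightarrow> finite I \<and> v ` I \<subseteq> C \<and> w ` I \<subseteq> C \<and> R = (\<Sum>i\<in>I. v i \<otimes> w i)"

private lemma tens_add_left: "x \<in> C \<Longrightarrow> y \<in> C \<Longrightarrow> z \<in> C \<Longrightarrow> (x + y) \<otimes> z = x \<otimes> z + y \<otimes> z"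
  and tens_add_right: "x \<in> C \<Longrightarrow> y \<in> C \<Longrightarrow> z \<in> C \<Longrightarrow> z \<otimes> (x + y) = z \<otimes> x + z \<otimes> y"
  and tens_scale_left: "x \<in> C \<Longrightarrow> z \<in> C \<Longrightarrow> s c x \<otimes> z = tscale c (x \<otimes> z)"
  and tens_scale_right: "x \<in> C \<Longrightarrow> z \<in> C \<Longrightarrow> z \<otimes> s c x = tscale c (z \<otimes> x)"
  using bilinear_tpure[of s C s C] unfolding bilinear_on_def linear_on_def by blast+

private lemma tens_sum_left:
  "finite J \<Longrightarrow> v ` J \<subseteq> C \<Longrightarrow> z \<in> C \<Longrightarrow> (\<Sum>j\<in>J. s (d j) (v j)) \<otimes> z = (\<Sum>j\<in>J. tscale (d j) (v j \<otimes> z))"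
proof (induction J rule: finite_induct)
  case empty
  show ?case using tens_scale_left[of z z 0] empty by simp
next
  case (insert j J)
  then show ?case
    by (simp add: tens_add_left tens_scale_left subspace_scale[OF sub] subspace_sum[OF sub] image_subset_iff)
qed

private lemma tens_sum_right:
  "finite J \<Longrightarrow> v ` J \<subseteq> C \<Longrightarrow> z \<in> C \<Longrightarrow> z \<otimes> (\<Sum>j\<in>J. s (d j) (v j)) = (\<Sum>j\<in>J. tscale (d j) (z \<otimes> v j))"
proof (induction J rule: finite_induct)
  case empty
  show ?case using tens_scale_right[of z z 0] empty by simp
next
  case (insert j J)
  then show ?case
    by (simp add: tens_add_right tens_scale_right subspace_scale[OF sub] subspace_sum[OF sub] image_subset_iff)
qed

private lemma solve_relation:
  assumes "finite I" "k \<in> I" "c k \<noteq> 0" "(\<Sum>i\<in>I. s (c i) (w i)) = 0"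
  shows "w k = (\<Sum>j\<in>I - {k}. s (- c j / c k) (w j))"
proof -
  have "s (c k) (w k) = - (\<Sum>j\<in>I - {k}. s (c j) (w j))"
    using assms by (simp add: sum.remove[of I k] eq_neg_iff_add_eq_0)
  hence "s (inverse (c k)) (s (c k) (w k)) = s (inverse (c k)) (- (\<Sum>j\<in>I - {k}. s (c j) (w j)))"
    by simp
  thus ?thesis
    using assms(3) by (simp add: scale_sum_right sum_negf divide_inverse mult.commute)
qed

private lemma reduce_right:
  assumes "rep I v w" "k \<in> I" "c k \<noteq> 0" "(\<Sum>i\<in>I. s (c i) (w i)) = 0"
  shows "\<exists>v'. rep (I - {k}) v' w"
proof -
  let ?J = "I - {k}"
  define d where "d = (\<lambda>j. - c j / c k)"
  have I: "finite I" "v ` I \<subseteq> C" "w ` I \<subseteq> C" "R = (\<Sum>i\<in>I. v i \<otimes> w i)"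
    using assms(1) by (auto simp: rep_def)
  have wk: "w k = (\<Sum>j\<in>?J. s (d j) (w j))"
    unfolding d_def by (rule solve_relation[OF I(1) assms(2-4)])
  have inC: "v i \<in> C" "w i \<in> C" if "i \<in> I" for i using I that by auto
  have "R = (\<Sum>j\<in>?J. v j \<otimes> w j) + v k \<otimes> (\<Sum>j\<in>?J. s (d j) (w j))"
    using I assms(2) by (simp add: sum.remove[of I k] wk[symmetric] add.commute)
  also have "v k \<otimes> (\<Sum>j\<in>?J. s (d j) (w j)) = (\<Sum>j\<in>?J. tscale (d j) (v k \<otimes> w j))"
    by (rule tens_sum_right) (use I inC assms(2) in auto)
  also have "(\<Sum>j\<in>?J. v j \<otimes> w j) + \<dots> = (\<Sum>j\<in>?J. (v j + s (d j) (v k)) \<otimes> w j)"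
    unfolding sum.distrib[symmetric]
    by (rule sum.cong) (use inC assms(2) in
      \<open>auto simp: tens_add_left tens_scale_left subspace_scale[OF sub]\<close>)
  finally have "rep ?J (\<lambda>j. v j + s (d j) (v k)) w"
    unfolding rep_def using I inC assms(2) by (auto intro!: subspace_add[OF sub] subspace_scale[OF sub])
  thus ?thesis by (rule exI[where x = "\<lambda>j. v j + s (d j) (v k)"])
qed

private lemma reduce_left:
  assumes "rep I v w" "k \<in> I" "c k \<noteq> 0" "(\<Sum>i\<in>I. s (c i) (v i)) = 0"
  shows "\<exists>w'. rep (I - {k}) v w'"
proof -
  let ?J = "I - {k}"
  define d where "d = (\<lambda>j. - c j / c k)"
  have I: "finite I" "v ` I \<subseteq> C" "w ` I \<subseteq> C" "R = (\<Sum>i\<in>I. v i \<otimes> w i)"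
    using assms(1) by (auto simp: rep_def)
  have vk: "v k = (\<Sum>j\<in>?J. s (d j) (v j))"
    unfolding d_def by (rule solve_relation[OF I(1) assms(2-4)])
  have inC: "v i \<in> C" "w i \<in> C" if "i \<in> I" for i using I that by auto
  have "R = (\<Sum>j\<in>?J. v j \<otimes> w j) + (\<Sum>j\<in>?J. s (d j) (v j)) \<otimes> w k"
    using I assms(2) by (simp add: sum.remove[of I k] vk[symmetric] add.commute)
  also have "(\<Sum>j\<in>?J. s (d j) (v j)) \<otimes> w k = (\<Sum>j\<in>?J. tscale (d j) (v j \<otimes> w k))"
    by (rule tens_sum_left) (use I inC assms(2) in auto)
  also have "(\<Sum>j\<in>?J. v j \<otimes> w j) + \<dots> = (\<Sum>j\<in>?J. v j \<otimes> (w j + s (d j) (w k)))"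
    unfolding sum.distrib[symmetric]
    by (rule sum.cong) (use inC assms(2) in
      \<open>auto simp: tens_add_right tens_scale_right subspace_scale[OF sub]\<close>)
  finally have "rep ?J v (\<lambda>j. w j + s (d j) (w k))"
    unfolding rep_def using I inC assms(2) by (auto intro!: subspace_add[OF sub] subspace_scale[OF sub])
  thus ?thesis by (rule exI[where x = "\<lambda>j. w j + s (d j) (w k)"])
qed

private lemma family_independent:
  fixes v :: "nat \<Rightarrow> 'v"
  assumes I: "finite I" and c: "\<And>c. (\<Sum>i\<in>I. s (c i) (v i)) = 0 \<Longrightarrow> \<forall>i\<in>I. c i = 0"
  shows "inj_on v I" "independent (v ` I)"
proof -
  show inj: "inj_on v I"
  proof (rule inj_onI, rule ccontr)
    fix i j assume ij: "i \<in> I" "j \<in> I" "v i = v j" "i \<noteq> j"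
    define c where "c = (\<lambda>l. if l = i then 1 else if l = j then -1 else 0 :: 'k)"
    have "(\<Sum>l\<in>I. s (c l) (v l)) = (\<Sum>l\<in>{i, j}. s (c l) (v l))"
      using I ij by (intro sum.mono_neutral_right) (auto simp: c_def)
    also have "\<dots> = 0" using ij by (simp add: c_def)
    finally have "c i = 0" using c ij by blast
    thus False by (simp add: c_def)
  qed
  show "independent (v ` I)"
  proof (rule independent_if_scalars_zero)
    fix f x assume f: "(\<Sum>x\<in>v ` I. s (f x) x) = 0" and "x \<in> v ` I"
    have "(\<Sum>i\<in>I. s (f (v i)) (v i)) = 0" using f by (simp add: sum.reindex[OF inj])
    from c[OF this] show "f x = 0" using \<open>x \<in> v ` I\<close> by auto
  qed (use I in auto)
qed

private lemma minimal_rep: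
  obtains I v w where "rep I v w" "inj_on v I" "independent (v ` I)" "inj_on w I" "independent (w ` I)"
proof -
  obtain xs where xs: "set xs \<subseteq> C \<times> C" "R = (\<Sum>(v, w)\<leftarrow>xs. v \<otimes> w)"
    using R unfolding tspace_def by blast
  have "R = (\<Sum>i\<in>{0..<length xs}. fst (xs ! i) \<otimes> snd (xs ! i))"
    unfolding xs(2) by (simp add: sum_list_sum_nth case_prod_beta)
  moreover have "fst (xs ! i) \<in> C" "snd (xs ! i) \<in> C" if "i < length xs" for i
    using xs(1) nth_mem[OF that] by (auto simp: mem_Times_iff)
  ultimately have "rep {0..<length xs} (\<lambda>i. fst (xs ! i)) (\<lambda>i. snd (xs ! i))"
    unfolding rep_def by auto
  hence ex: "\<exists>m I v w. rep I v w \<and> card I = m" by blast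
  define m where "m = (LEAST m. \<exists>I v w. rep I v w \<and> card I = m)"
  obtain I v w where I: "rep I v w" "card I = m"
    using LeastI_ex[OF ex] unfolding m_def by blast
  have least: "m \<le> card J" if "rep J v' w'" for J v' w'
    unfolding m_def by (rule Least_le) (use that in blast)
  have fin: "finite I" using I by (simp add: rep_def)
  have no: "\<not> rep (I - {k}) v' w'" if "k \<in> I" for k v' w'
    using least[of "I - {k}" v' w'] I fin that card_Diff1_less[OF fin that] by auto
  have "\<forall>i\<in>I. c i = 0" if "(\<Sum>i\<in>I. s (c i) (v i)) = 0" for c
    using reduce_left[OF I(1) _ _ that] no by blast
  note * = family_independent[of I v, OF fin this]
  have "\<forall>i\<in>I. c i = 0" if "(\<Sum>i\<in>I. s (c i) (w i)) = 0" for c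
    using reduce_right[OF I(1) _ _ that] no by blast
  note ** = family_independent[of I w, OF fin this]
  show ?thesis using that[OF I(1)] * ** by blast
qed

private lemma functional_values:
  assumes "inj_on v I" "independent (v ` I)"
  obtains \<xi> where "linear_on s C (*) \<xi>" "\<And>i. i \<in> I \<Longrightarrow> \<xi> (v i) = c i"
proof -
  obtain \<xi> where \<xi>: "Vector_Spaces.linear s (*) \<xi> \<and> (\<forall>x\<in>v ` I. \<xi> x = c (inv_into I v x))"
    using K.linear_independent_extend[OF assms(2), of "\<lambda>x. c (inv_into I v x)"] by (rule exE)
  have "Vector_Spaces.linear s (*) \<xi>" using \<xi> by (rule conjunct1)
  interpret X: Vector_Spaces.linear s "(*)" \<xi> by fact
  show ?thesis
    by (rule that[of \<xi>]) (use conjunct2[OF \<xi>] assms(1) in \<open>auto simp: linear_on_def X.add X.scale\<close>)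
qed

private lemma span_family:
  assumes "finite I" "inj_on w I"
  shows "span (w ` I) = range (\<lambda>c. \<Sum>i\<in>I. s (c i) (w i))"
proof (intro equalityI subsetI)
  fix x assume "x \<in> span (w ` I)"
  then obtain f where "x = (\<Sum>y\<in>w ` I. s (f y) y)"
    using assms(1) by (auto simp: span_finite)
  hence "x = (\<Sum>i\<in>I. s (f (w i)) (w i))" by (simp add: sum.reindex[OF assms(2)])
  thus "x \<in> range (\<lambda>c. \<Sum>i\<in>I. s (c i) (w i))"
    by (rule image_eqI[where x = "\<lambda>i. f (w i)"]) simp
next
  fix x assume "x \<in> range (\<lambda>c. \<Sum>i\<in>I. s (c i) (w i))"
  thus "x \<in> span (w ` I)" by (auto intro!: span_sum span_scale intro: span_base)
qed

theorem rank_eq_dim_R_right: "qt_rank s C R = dim (R_right s C R)"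
proof -
  obtain I v w where I: "rep I v w" and v: "inj_on v I" "independent (v ` I)"
    and w: "inj_on w I" "independent (w ` I)"
    by (rule minimal_rep)
  have fin: "finite I" and inC: "\<And>i. i \<in> I \<Longrightarrow> v i \<in> C" "\<And>i. i \<in> I \<Longrightarrow> w i \<in> C"
    and R_eq: "R = (\<Sum>i\<in>I. v i \<otimes> w i)"
    using I by (auto simp: rep_def)
  have right: "tlift s C s C (\<lambda>x y. s (\<xi> x) y) R = (\<Sum>i\<in>I. s (\<xi> (v i)) (w i))"
    and left: "tlift s C s C (\<lambda>x y. s (\<xi> y) x) R = (\<Sum>i\<in>I. s (\<xi> (w i)) (v i))"
    if "linear_on s C (*) \<xi>" for \<xi>
    unfolding R_eq
    by (rule tlift_sum_set[OF vs _ fin inC]; use that in \<open>auto simp: bilinear_on_def linear_on_def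
      scale_left_distrib scale_right_distrib mult.commute\<close>)+
  have "R_right s C R = span (w ` I)"
  proof (intro equalityI subsetI)
    fix x assume "x \<in> R_right s C R"
    thus "x \<in> span (w ` I)" unfolding span_family[OF fin w(1)] R_right_def using right by auto
  next
    fix x assume "x \<in> span (w ` I)"
    then obtain c where x: "x = (\<Sum>i\<in>I. s (c i) (w i))" unfolding span_family[OF fin w(1)] by blast
    obtain \<xi> where \<xi>: "linear_on s C (*) \<xi>" "\<And>i. i \<in> I \<Longrightarrow> \<xi> (v i) = c i"
      using functional_values[OF v] by blast
    have "x = tlift s C s C (\<lambda>x y. s (\<xi> x) y) R" using \<xi> by (simp add: right x)
    thus "x \<in> R_right s C R" unfolding R_right_def using \<xi>(1) by blast
  qed
  moreover have "R_left s C R = span (v ` I)"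
  proof (intro equalityI subsetI)
    fix x assume "x \<in> R_left s C R"
    thus "x \<in> span (v ` I)" unfolding span_family[OF fin v(1)] R_left_def using left by auto
  next
    fix x assume "x \<in> span (v ` I)"
    then obtain c where x: "x = (\<Sum>i\<in>I. s (c i) (v i))" unfolding span_family[OF fin v(1)] by blast
    obtain \<xi> where \<xi>: "linear_on s C (*) \<xi>" "\<And>i. i \<in> I \<Longrightarrow> \<xi> (w i) = c i"
      using functional_values[OF w] by blast
    have "x = tlift s C s C (\<lambda>x y. s (\<xi> y) x) R" using \<xi> by (simp add: left x)
    thus "x \<in> R_left s C R" unfolding R_left_def using \<xi>(1) by blast
  qed
  ultimately show ?thesis
    unfolding qt_rank_def
    by (simp add: dim_eq_card_independent[OF v(2)] dim_eq_card_independent[OF w(2)]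
      card_image[OF v(1)] card_image[OF w(1)])
qed

end

definition corresponding ::
  "('k::field \<Rightarrow> 'v::ab_group_add \<Rightarrow> 'v) \<Rightarrow> 'v set \<Rightarrow> ('v \<Rightarrow> 'a::ring_1 \<Rightarrow> 'a) \<Rightarrow> ('k, 'v, 'v) tensor \<Rightarrow>
   ('k \<Rightarrow> 'w::ab_group_add \<Rightarrow> 'w) \<Rightarrow> 'w set \<Rightarrow> ('w \<Rightarrow> 'a \<Rightarrow> 'a) \<Rightarrow> ('k, 'w, 'w) tensor \<Rightarrow> bool"
  where "corresponding sH CH actH R sE CE actE R' \<longleftrightarrow>
    (\<forall>a b. tlift sH CH sH CH (\<lambda>x y. actH y b * actH x a) R =
           tlift sE CE sE CE (\<lambda>x y. actE y a * actE x b) R')"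

end

theory Submission
  imports "HOL-Algebra.Free_Abelian_Groups" Defs
begin

text \<open>Write \<open>R' = \<Sum>\<^sub>y q\<^sub>y \<otimes> y\<close> with all \<open>q\<^sub>y\<close> in \<open>Q = R_left\<close> (\<open>tensor_expansion_R_left\<close>). For \<open>R = 1 \<otimes> 1\<close> the
  correspondence reads \<open>b a = \<Sum>\<^sub>y y(a) q\<^sub>y(b)\<close>, so right multiplication by any \<open>a\<close> belongs to the subspace
  \<open>A \<cdot> Q\<close> of \<open>End A\<close>, and so does every map \<open>b \<mapsto> c b a\<close>. As \<open>A\<close> is central simple, \<open>A \<otimes> A\<^sup>o\<^sup>p \<rightarrow> End A\<close> is
  injective (\<open>central_simple_two_sided_independent\<close>), whence \<open>(dim A)\<^sup>2 \<le> dim A \<cdot> dim Q\<close>.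

  Conversely, \<open>Q\<close> lies in \<open>E = End\<^sub>H A\<close>, and \<open>dim E \<le> dim A\<close> because \<open>A \<otimes> E \<rightarrow> End A\<close>, \<open>a \<otimes> \<phi> \<mapsto> a \<phi>\<close>, is injective: its
  kernel is stable under the operators \<open>x \<mapsto> a (h x)\<close> on the first factor
  (\<open>End_H_left_independent\<close>), and by the Galois property every endomorphism of \<open>A\<close> is a sum of these.

  Both counts require \<open>dim A < \<infinity>\<close>. This too follows from the Galois property, since in infinite
  dimension there are more endomorphisms than the operators from \<open>A \<otimes> H\<close> can provide
  (\<open>galois_finite_basis\<close>).\<close>

section \<open>Linear algebra\<close>

lemma sum_apply: "(\<Sum>i\<in>I. f i) x = (\<Sum>i\<in>I. f i x)"
  for f :: "'i \<Rightarrow> 'x \<Rightarrow> 'u::comm_monoid_add"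
  by (induction I rule: infinite_finite_induct) auto

lemma (in vector_space) independent_family_card_le:
  assumes "finite I" and indep: "\<And>c. (\<Sum>i\<in>I. scale (c i) (f i)) = 0 \<Longrightarrow> \<forall>i\<in>I. c i = 0"
    and "f ` I \<subseteq> span T" "finite T"
  shows "card I \<le> card T"
proof -
  have inj: "inj_on f I"
  proof (rule inj_onI, rule ccontr)
    fix i j assume ij: "i \<in> I" "j \<in> I" "f i = f j" "i \<noteq> j"
    define c where "c = (\<lambda>l. if l = i then 1 else if l = j then -1 else 0 :: 'a)"
    have "(\<Sum>l\<in>I. scale (c l) (f l)) = (\<Sum>l\<in>{i, j}. scale (c l) (f l))"
      using assms(1) ij by (intro sum.mono_neutral_right) (auto simp: c_def)
    also have "\<dots> = 0" using ij by (simp add: c_def)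
    finally have "c i = 0" using indep ij by blast
    thus False by (simp add: c_def)
  qed
  have "independent (f ` I)"
  proof (rule independent_if_scalars_zero)
    fix c x assume c: "(\<Sum>x\<in>f ` I. scale (c x) x) = 0" and "x \<in> f ` I"
    have "(\<Sum>i\<in>I. scale (c (f i)) (f i)) = 0" using c by (simp add: sum.reindex[OF inj])
    from indep[OF this] show "c x = 0" using \<open>x \<in> f ` I\<close> by auto
  qed (use assms in auto)
  from independent_span_bound[OF assms(4) this assms(3)] show ?thesis
    by (simp add: card_image[OF inj])
qed

lemma (in vector_space) finite_subset_span:
  assumes "finite X" "X \<subseteq> span B"
  obtains V where "finite V" "V \<subseteq> B" "X \<subseteq> span V"
proof -
  have "\<exists>V. finite V \<and> V \<subseteq> B \<and> x \<in> span V" if x: "x \<in> X" for x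
  proof -
    obtain t r where t: "finite t" "t \<subseteq> B" "x = (\<Sum>a\<in>t. scale (r a) a)"
      using subsetD[OF assms(2) x] by (auto simp: span_explicit)
    have "x \<in> span t" unfolding t(3) by (intro span_sum span_scale span_base)
    with t show ?thesis by blast
  qed
  then obtain V where V: "\<And>x. x \<in> X \<Longrightarrow> finite (V x) \<and> V x \<subseteq> B \<and> x \<in> span (V x)" by metis
  have "X \<subseteq> span (\<Union>x\<in>X. V x)"
  proof
    fix x assume "x \<in> X"
    with V show "x \<in> span (\<Union>x\<in>X. V x)" by (meson UN_upper span_mono subsetD)
  qed
  thus ?thesis using that[of "\<Union>x\<in>X. V x"] V assms(1) by auto
qed

lemma (in vector_space) linear_functional_one:
  assumes "u \<noteq> 0"
  obtains \<xi> where "Vector_Spaces.linear scale (*) \<xi>" "\<xi> u = 1"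
proof -
  interpret K: vector_space "(*) :: 'a \<Rightarrow> 'a \<Rightarrow> 'a" by (rule vector_space_field)
  interpret P: vector_space_pair scale "(*) :: 'a \<Rightarrow> 'a \<Rightarrow> 'a" ..
  have "independent {u}" using assms by simp
  from P.linear_independent_extend[OF this, of "\<lambda>_. 1"] show ?thesis using that by auto
qed

text \<open>A diagonal argument. An infinite basis \<open>B\<close> has no more finite subsets than elements, so the finite
  subsets of \<open>B\<close> can be listed by the elements of \<open>B\<close>. An endomorphism that sends the basis vector
  listing \<open>V\<close> outside of the finite dimensional space prescribed by \<open>V\<close> is confined by no \<open>V\<close>.\<close>

lemma (in vector_space) finite_basis_if_endomorphisms_confined:
  assumes B: "independent B" "span B = UNIV" and W: "\<And>v x. finite (W v x)"
    and conf: "\<And>f. Vector_Spaces.linear scale scale f \<Longrightarrow>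
      \<exists>V. finite V \<and> V \<subseteq> B \<and> (\<forall>x. f x \<in> span (\<Union>v\<in>V. W v x))"
  shows "finite B"
proof (rule ccontr)
  assume inf: "infinite B"
  interpret P: vector_space_pair scale scale ..
  obtain g where g: "bij_betw g B (Fpow B)"
    using eqpoll_sym[OF eqpoll_Fpow[OF inf]] unfolding eqpoll_def by blast
  have "\<exists>y. y \<notin> span (\<Union>v\<in>g x. W v x)" if "x \<in> B" for x
  proof (rule ccontr)
    assume "\<not> ?thesis"
    hence "B \<subseteq> span (\<Union>v\<in>g x. W v x)" by blast
    moreover have "finite (g x)" using g that by (auto simp: bij_betw_def Fpow_def)
    ultimately have "finite B"
      using independent_span_bound[OF _ B(1), of "\<Union>v\<in>g x. W v x"] W by auto
    with inf show False ..
  qed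
  then obtain f0 where f0: "\<And>x. x \<in> B \<Longrightarrow> f0 x \<notin> span (\<Union>v\<in>g x. W v x)" by metis
  obtain f where f: "Vector_Spaces.linear scale scale f" "\<forall>x\<in>B. f x = f0 x"
    using P.linear_independent_extend[OF B(1), of f0] by blast
  obtain V where V: "finite V" "V \<subseteq> B" "\<And>x. f x \<in> span (\<Union>v\<in>V. W v x)" using conf[OF f(1)] by blast
  have "V \<in> g ` B" using V g by (auto simp: bij_betw_def Fpow_def)
  then obtain x where "x \<in> B" "g x = V" by auto
  with f0[of x] f(2) V(3)[of x] show False by auto
qed


lemma linear_onI:
  assumes "\<And>x y. x \<in> V \<Longrightarrow> y \<in> V \<Longrightarrow> f (x + y) = f x + f y"
    and "\<And>c x. x \<in> V \<Longrightarrow> f (s c x) = t c (f x)"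
  shows "linear_on s V t f"
  using assms by (simp add: linear_on_def)

lemma linear_on_compose:
  assumes "linear_on s V t f" "f ` V \<subseteq> W" "linear_on t W u g"
  shows "linear_on s V u (\<lambda>x. g (f x))"
  using assms unfolding linear_on_def by (simp add: image_subset_iff)

lemma bilinear_onI:
  assumes "\<And>w. w \<in> W \<Longrightarrow> linear_on sV V t (\<lambda>v. g v w)" "\<And>v. v \<in> V \<Longrightarrow> linear_on sW W t (g v)"
  shows "bilinear_on sV V sW W t g"
  using assms by (simp add: bilinear_on_def)

lemma bilinear_onD:
  assumes "bilinear_on sV V sW W t g"
  shows "w \<in> W \<Longrightarrow> linear_on sV V t (\<lambda>v. g v w)" "v \<in> V \<Longrightarrow> linear_on sW W t (g v)"
  using assms by (simp_all add: bilinear_on_def)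

lemma linear_on_sum:
  assumes "vector_space s" "vector_space t" "module.subspace s V" "linear_on s V t f"
    and "\<And>i. i \<in> I \<Longrightarrow> x i \<in> V"
  shows "f (\<Sum>i\<in>I. s (c i) (x i)) = (\<Sum>i\<in>I. t (c i) (f (x i)))"
proof -
  interpret S: vector_space s by fact
  interpret T: vector_space t by fact
  note V = S.subspace_0[OF assms(3)] S.subspace_scale[OF assms(3)] S.subspace_sum[OF assms(3)]
  have "f (s 0 0) = t 0 (f 0)" using assms(4) V unfolding linear_on_def by blast
  hence f0: "f 0 = 0" by simp
  show ?thesis
    using assms(5)
  proof (induction I rule: infinite_finite_induct)
    case (insert i I)
    have "s (c i) (x i) \<in> V" "(\<Sum>i\<in>I. s (c i) (x i)) \<in> V" using insert by (auto intro!: V)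
    with insert assms(4) show ?case by (simp add: linear_on_def)
  qed (auto simp: f0)
qed

lemma bilinear_on_span:
  assumes "vector_space s" "vector_space t" "vector_space u"
    and "module.subspace s V" "module.subspace t W" and m: "bilinear_on s V t W u m"
    and "P \<subseteq> V" "Q \<subseteq> W" and x: "x \<in> module.span s P" and y: "y \<in> module.span t Q"
  shows "m x y \<in> module.span u ((\<lambda>(p, q). m p q) ` (P \<times> Q))"
proof -
  interpret S: vector_space s by fact
  interpret T: vector_space t by fact
  interpret U: vector_space u by fact
  obtain I c where I: "finite I" "I \<subseteq> P" "x = (\<Sum>a\<in>I. s (c a) a)"
    using x unfolding S.span_explicit by blast
  obtain J d where J: "finite J" "J \<subseteq> Q" "y = (\<Sum>a\<in>J. t (d a) a)"
    using y unfolding T.span_explicit by blast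
  have "x \<in> V" unfolding I(3) using I assms(7)
    by (intro S.subspace_sum[OF assms(4)] S.subspace_scale[OF assms(4)]) auto
  have "m x y = (\<Sum>b\<in>J. u (d b) (m x b))"
    unfolding J(3) by (rule linear_on_sum[OF assms(2,3,5) bilinear_onD(2)[OF m \<open>x \<in> V\<close>]])
      (use J assms in auto)
  also have "\<dots> = (\<Sum>b\<in>J. u (d b) (\<Sum>a\<in>I. u (c a) (m a b)))"
    unfolding I(3) by (intro sum.cong refl arg_cong[where f = "u _"]
      linear_on_sum[OF assms(1,3,4) bilinear_onD(1)[OF m]]) (use I J assms in auto)
  also have "\<dots> \<in> module.span u ((\<lambda>(p, q). m p q) ` (P \<times> Q))"
    by (intro U.span_sum U.span_scale U.span_base) (use I J in auto)
  finally show ?thesis .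
qed

lemma endomorphisms_span:
  assumes "vector_space s" "finite B" "\<not> module.dependent s B" "module.span s B = UNIV"
  obtains T where "finite T" "card T \<le> card B * card B" "End s \<subseteq> module.span (fun_scale s) T"
proof -
  interpret A: vector_space s by fact
  interpret F: vector_space "fun_scale s" by (rule vector_space_fun_scale) fact
  let ?r = "A.representation B"
  define e where "e = (\<lambda>(b, b') x. s (?r x b) b')"
  have expand: "x = (\<Sum>b\<in>B. s (?r x b) b)" for x
    using A.sum_representation_eq[OF assms(3) _ assms(2) order_refl, of x] assms(4) by simp
  have "f \<in> F.span (e ` (B \<times> B))" if "f \<in> End s" for f
  proof -
    from that interpret f: Vector_Spaces.linear s s f by (simp add: End_def)
    have "f = (\<Sum>(b, b')\<in>B \<times> B. fun_scale s (?r (f b) b') (e (b, b')))"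
    proof
      fix x
      have "f x = (\<Sum>b\<in>B. s (?r x b) (f b))"
        by (subst expand[of x]) (simp add: f.sum f.scale)
      also have "\<dots> = (\<Sum>b\<in>B. s (?r x b) (\<Sum>b'\<in>B. s (?r (f b) b') b'))"
        using expand by simp
      also have "\<dots> = (\<Sum>(b, b')\<in>B \<times> B. fun_scale s (?r (f b) b') (e (b, b'))) x"
        by (simp add: sum_apply sum.cartesian_product' A.scale_sum_right
          fun_scale_def e_def mult.commute)
      finally show "f x = (\<Sum>(b, b')\<in>B \<times> B. fun_scale s (?r (f b) b') (e (b, b'))) x" .
    qed
    also have "\<dots> \<in> F.span (e ` (B \<times> B))"
      unfolding case_prod_beta by (intro F.span_sum F.span_scale F.span_base) auto
    finally show ?thesis .
  qed
  moreover have "card (e ` (B \<times> B)) \<le> card B * card B"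
    using card_image_le[of "B \<times> B" e] assms(2) by (simp add: card_cartesian_product)
  ultimately show ?thesis using that[of "e ` (B \<times> B)"] assms(2) by blast
qed

section \<open>Tensors\<close>

lemma tspaceI:
  fixes sV :: "'k::field \<Rightarrow> 'v::ab_group_add \<Rightarrow> 'v" and sW :: "'k \<Rightarrow> 'w::ab_group_add \<Rightarrow> 'w"
  assumes "finite I" "\<And>i. i \<in> I \<Longrightarrow> v i \<in> V" "\<And>i. i \<in> I \<Longrightarrow> w i \<in> W"
  shows "(\<Sum>i\<in>I. tpure sV V sW W (v i) (w i)) \<in> tspace sV V sW W"
proof -
  obtain ns where ns: "set ns = I" "distinct ns" using finite_distinct_list[OF assms(1)] by blast
  have "(\<Sum>i\<in>I. tpure sV V sW W (v i) (w i)) =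
      (\<Sum>(x, y)\<leftarrow>map (\<lambda>i. (v i, w i)) ns. tpure sV V sW W x y)"
    using ns by (simp add: o_def sum_list_distinct_conv_sum_set)
  moreover have "set (map (\<lambda>i. (v i, w i)) ns) \<subseteq> V \<times> W" using assms ns by auto
  ultimately show ?thesis unfolding tspace_def by blast
qed

lemma tspaceE:
  assumes "T \<in> tspace sV V sW W"
  obtains n :: nat and v w where "\<And>i. i < n \<Longrightarrow> v i \<in> V" "\<And>i. i < n \<Longrightarrow> w i \<in> W"
    "T = (\<Sum>i<n. tpure sV V sW W (v i) (w i))"
proof -
  obtain xs where xs: "set xs \<subseteq> V \<times> W" "T = (\<Sum>(v, w)\<leftarrow>xs. tpure sV V sW W v w)"
    using assms unfolding tspace_def by blast
  have T: "T = (\<Sum>i<length xs. tpure sV V sW W (fst (xs ! i)) (snd (xs ! i)))"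
    unfolding xs(2) by (simp add: sum_list_sum_nth case_prod_beta lessThan_atLeast0)
  have inVW: "fst (xs ! i) \<in> V" "snd (xs ! i) \<in> W" if "i < length xs" for i
    using xs(1) nth_mem[OF that] by (auto simp: mem_Times_iff)
  show ?thesis by (rule that[of "length xs" "\<lambda>i. fst (xs ! i)" "\<lambda>i. snd (xs ! i)", OF inVW T])
qed

lemma tpure_in_tspace: "v \<in> V \<Longrightarrow> w \<in> W \<Longrightarrow> tpure sV V sW W v w \<in> tspace sV V sW W"
  using tspaceI[of "{()}" "\<lambda>_. v" V "\<lambda>_. w" W sV sW] by simp

lemma tlift_tpure:
  assumes "vector_space sU" "bilinear_on sV V sW W sU g" "v \<in> V" "w \<in> W"
  shows "tlift sV V sW W g (tpure sV V sW W v w) = g v w"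
  using tlift_sum_set[OF assms(1,2), of "{()}" "\<lambda>_. v" "\<lambda>_. w"] assms(3,4) by simp

lemma tlift_cong:
  assumes "\<And>v w. v \<in> V \<Longrightarrow> w \<in> W \<Longrightarrow> g v w = g' v w"
  shows "tlift sV V sW W g T = tlift sV V sW W g' T"
proof -
  have "(\<Sum>(v, w)\<leftarrow>xs. g v w) = (\<Sum>(v, w)\<leftarrow>xs. g' v w)" if "set xs \<subseteq> V \<times> W" for xs
    using assms that by (intro arg_cong[where f = sum_list] map_cong) auto
  thus ?thesis unfolding tlift_def by (intro arg_cong[where f = Eps] ext) auto
qed

lemma vector_space_tscale: "vector_space (tscale :: 'k::field \<Rightarrow> ('k, 'v, 'w) tensor \<Rightarrow> _)"
  by (intro vector_space_fun_scale vector_space_field)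

context
  fixes sV :: "'k::field \<Rightarrow> 'v::ab_group_add \<Rightarrow> 'v" and V :: "'v set"
    and sW :: "'k \<Rightarrow> 'w::ab_group_add \<Rightarrow> 'w" and W :: "'w set"
  assumes vsV: "vector_space sV" and subV: "module.subspace sV V"
begin

interpretation V: vector_space sV by (rule vsV)
interpretation T: vector_space "tscale :: 'k \<Rightarrow> ('k, 'v, 'w) tensor \<Rightarrow> _" by (rule vector_space_tscale)

lemma subspace_tspace: "T.subspace (tspace sV V sW W)"
proof (rule T.subspaceI)
  show "0 \<in> tspace sV V sW W" using tspaceI[of "{}"] by simp
next
  fix T T' assume "T \<in> tspace sV V sW W" "T' \<in> tspace sV V sW W"
  then obtain xs ys where "set xs \<subseteq> V \<times> W" "T = (\<Sum>(v, w)\<leftarrow>xs. tpure sV V sW W v w)"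
    "set ys \<subseteq> V \<times> W" "T' = (\<Sum>(v, w)\<leftarrow>ys. tpure sV V sW W v w)"
    unfolding tspace_def by blast
  hence "set (xs @ ys) \<subseteq> V \<times> W \<and> T + T' = (\<Sum>(v, w)\<leftarrow>xs @ ys. tpure sV V sW W v w)" by simp
  thus "T + T' \<in> tspace sV V sW W" unfolding tspace_def by blast
next
  fix c T assume "T \<in> tspace sV V sW W"
  then obtain n :: nat and v w where T: "\<And>i. i < n \<Longrightarrow> v i \<in> V" "\<And>i. i < n \<Longrightarrow> w i \<in> W"
    "T = (\<Sum>i<n. tpure sV V sW W (v i) (w i))" by (rule tspaceE) blast
  have "tscale c T = (\<Sum>i<n. tpure sV V sW W (sV c (v i)) (w i))"
    unfolding T(3) T.scale_sum_right using bilinear_tpure[of sV V sW W] T(1,2)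
    by (intro sum.cong) (auto simp: bilinear_on_def linear_on_def)
  thus "tscale c T \<in> tspace sV V sW W" 
    using tspaceI[of "{..<n}" "\<lambda>i. sV c (v i)" V w W sV sW] T V.subspace_scale[OF subV] by simp
qed

lemma tlift_linear:
  assumes "vector_space sU" "bilinear_on sV V sW W sU g"
  shows "linear_on tscale (tspace sV V sW W) sU (tlift sV V sW W g)"
proof (rule linear_onI)
  fix T T' assume "T \<in> tspace sV V sW W" "T' \<in> tspace sV V sW W"
  then obtain xs ys where *: "set xs \<subseteq> V \<times> W" "T = (\<Sum>(v, w)\<leftarrow>xs. tpure sV V sW W v w)"
    "set ys \<subseteq> V \<times> W" "T' = (\<Sum>(v, w)\<leftarrow>ys. tpure sV V sW W v w)"
    unfolding tspace_def by blast
  hence "T + T' = (\<Sum>(v, w)\<leftarrow>xs @ ys. tpure sV V sW W v w)" by simp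
  thus "tlift sV V sW W g (T + T') = tlift sV V sW W g T + tlift sV V sW W g T'"
    using tlift_sum[OF assms, of xs] tlift_sum[OF assms, of ys] tlift_sum[OF assms, of "xs @ ys"] *
    by simp
next
  fix c T assume "T \<in> tspace sV V sW W"
  then obtain n :: nat and v w where T: "\<And>i. i < n \<Longrightarrow> v i \<in> V" "\<And>i. i < n \<Longrightarrow> w i \<in> W"
    "T = (\<Sum>i<n. tpure sV V sW W (v i) (w i))" by (rule tspaceE) blast
  interpret U: vector_space sU by fact
  have "tscale c T = (\<Sum>i<n. tpure sV V sW W (sV c (v i)) (w i))"
    unfolding T(3) T.scale_sum_right using bilinear_tpure[of sV V sW W] T(1,2)
    by (intro sum.cong) (auto simp: bilinear_on_def linear_on_def)
  hence "tlift sV V sW W g (tscale c T) = (\<Sum>i<n. g (sV c (v i)) (w i))"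
    using tlift_sum_set[OF assms, of "{..<n}" "\<lambda>i. sV c (v i)" w] T V.subspace_scale[OF subV] by simp
  also have "\<dots> = (\<Sum>i<n. sU c (g (v i) (w i)))"
    using assms(2) T(1,2) by (intro sum.cong) (auto simp: bilinear_on_def linear_on_def)
  also have "\<dots> = sU c (tlift sV V sW W g T)"
    using tlift_sum_set[OF assms, of "{..<n}" v w] T by (simp add: U.scale_sum_right)
  finally show "tlift sV V sW W g (tscale c T) = sU c (tlift sV V sW W g T)" .
qed

end

text \<open>Naturality of the lift. Together with \<open>tlift_linear\<close> and \<open>tlift_linear_parameter\<close> it allows nested
  lifts, that is, iterated Sweedler sums, to be rewritten without choosing representatives.\<close>

lemma linear_tlift:
  assumes "vector_space sU" "vector_space sX" "bilinear_on sV V sW W sU g"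
    and g: "\<And>v w. v \<in> V \<Longrightarrow> w \<in> W \<Longrightarrow> g v w \<in> U" and "module.subspace sU U"
    and L: "linear_on sU U sX L" and "T \<in> tspace sV V sW W"
  shows "L (tlift sV V sW W g T) = tlift sV V sW W (\<lambda>v w. L (g v w)) T"
proof -
  obtain n :: nat and v w where T: "\<And>i. i < n \<Longrightarrow> v i \<in> V" "\<And>i. i < n \<Longrightarrow> w i \<in> W"
    "T = (\<Sum>i<n. tpure sV V sW W (v i) (w i))" using assms(7) by (rule tspaceE) blast
  interpret U: vector_space sU by fact
  interpret X: vector_space sX by fact
  have bil: "bilinear_on sV V sW W sX (\<lambda>v w. L (g v w))"
    by (intro bilinear_onI linear_on_compose[OF _ _ L] bilinear_onD[OF assms(3)]) (use g in auto)
  have "L (tlift sV V sW W g T) = L (\<Sum>i<n. sU 1 (g (v i) (w i)))"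
    unfolding T(3) by (subst tlift_sum_set[OF assms(1,3)]) (use T in auto)
  also have "\<dots> = (\<Sum>i<n. sX 1 (L (g (v i) (w i))))"
    by (rule linear_on_sum[OF assms(1,2,5) L]) (use T g in auto)
  also have "\<dots> = tlift sV V sW W (\<lambda>v w. L (g v w)) T"
    unfolding T(3) by (subst tlift_sum_set[OF assms(2) bil]) (use T in auto)
  finally show ?thesis .
qed

lemma tlift_in_subspace:
  assumes "vector_space sU" "bilinear_on sV V sW W sU g"
    and "\<And>v w. v \<in> V \<Longrightarrow> w \<in> W \<Longrightarrow> g v w \<in> U" and "module.subspace sU U"
    and "T \<in> tspace sV V sW W"
  shows "tlift sV V sW W g T \<in> U"
proof -
  interpret U: vector_space sU by fact
  obtain n :: nat and v w where T: "\<And>i. i < n \<Longrightarrow> v i \<in> V" "\<And>i. i < n \<Longrightarrow> w i \<in> W"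
    "T = (\<Sum>i<n. tpure sV V sW W (v i) (w i))" using assms(5) by (rule tspaceE) blast
  have "tlift sV V sW W g T = (\<Sum>i<n. g (v i) (w i))"
    unfolding T(3) by (rule tlift_sum_set[OF assms(1,2)]) (use T in auto)
  also have "\<dots> \<in> U" by (rule U.subspace_sum[OF assms(4)]) (use assms(3) T in auto)
  finally show ?thesis .
qed

lemma tlift_linear_parameter:
  assumes "vector_space sU" "\<And>z. z \<in> Z \<Longrightarrow> bilinear_on sV V sW W sU (g z)"
    and "\<And>v w. v \<in> V \<Longrightarrow> w \<in> W \<Longrightarrow> linear_on sZ Z sU (\<lambda>z. g z v w)"
    and "vector_space sZ" "module.subspace sZ Z" and "T \<in> tspace sV V sW W"
  shows "linear_on sZ Z sU (\<lambda>z. tlift sV V sW W (g z) T)"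
proof -
  obtain n :: nat and v w where T: "\<And>i. i < n \<Longrightarrow> v i \<in> V" "\<And>i. i < n \<Longrightarrow> w i \<in> W"
    "T = (\<Sum>i<n. tpure sV V sW W (v i) (w i))" using assms(6) by (rule tspaceE) blast
  interpret U: vector_space sU by fact
  interpret Z: vector_space sZ by fact
  have eq: "tlift sV V sW W (g z) T = (\<Sum>i<n. g z (v i) (w i))" if "z \<in> Z" for z
    unfolding T(3) by (subst tlift_sum_set[OF assms(1) assms(2)[OF that]]) (use T in auto)
  show ?thesis
    using assms(3) T(1,2) Z.subspace_add[OF assms(5)] Z.subspace_scale[OF assms(5)]
    by (intro linear_onI) (auto simp: eq linear_on_def sum.distrib U.scale_sum_right)
qed

text \<open>Choosing a basis of the right tensor factor and collecting the coefficients of each basis vector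
  \<open>y\<close> turns \<open>R\<close> into \<open>\<Sum>\<^sub>y q y \<otimes> y\<close>. The coefficient \<open>q y\<close> is the contraction of \<open>R\<close> with the coordinate
  functional of \<open>y\<close>, so it lies in \<open>R_left\<close>.\<close>

lemma tensor_expansion_R_left:
  assumes "vector_space s" "module.subspace s C" "R \<in> tspace s C s C"
  obtains Y q where "finite Y" "Y \<subseteq> C" "\<And>y. y \<in> Y \<Longrightarrow> q y \<in> R_left s C R \<inter> C"
    "R = (\<Sum>y\<in>Y. tpure s C s C (q y) y)"
proof -
  interpret vector_space s by fact
  interpret T: vector_space "tscale :: 'a \<Rightarrow> ('a, 'b, 'b) tensor \<Rightarrow> _" by (rule vector_space_tscale)
  note sub = assms(2) note bil = bilinear_onD[OF bilinear_tpure[of s C s C]]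
  obtain B where B: "B \<subseteq> C" "independent B" "C \<subseteq> span B" by (rule maximal_independent_subset)
  obtain n :: nat and v w where T: "\<And>i. i < n \<Longrightarrow> v i \<in> C" "\<And>i. i < n \<Longrightarrow> w i \<in> C"
    "R = (\<Sum>i<n. tpure s C s C (v i) (w i))" using assms(3) by (rule tspaceE) blast
  let ?r = "representation B"
  define Y where "Y = (\<Union>i<n. {y. ?r (w i) y \<noteq> 0})"
  have fin: "finite Y" by (auto simp: Y_def finite_representation)
  have YB: "Y \<subseteq> B" by (auto simp: Y_def dest: representation_ne_zero)
  have w: "w i = (\<Sum>y\<in>Y. s (?r (w i) y) y)" if "i < n" for i
  proof -
    have "w i \<in> span B" using T that B by blast
    from sum_nonzero_representation_eq[OF B(2) this]
    have "w i = (\<Sum>y | ?r (w i) y \<noteq> 0. s (?r (w i) y) y)" by simp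
    also have "\<dots> = (\<Sum>y\<in>Y. s (?r (w i) y) y)"
      by (rule sum.mono_neutral_left[OF fin]) (use that in \<open>auto simp: Y_def\<close>)
    finally show ?thesis .
  qed
  define q where "q = (\<lambda>y. \<Sum>i<n. s (?r (w i) y) (v i))"
  have coord: "linear_on s C (*) (\<lambda>x. ?r x y)" for y
    using B by (intro linear_onI) (auto simp: representation_add representation_scale subset_iff)
  have lft: "tlift s C s C (\<lambda>x x'. s (?r x' y) x) R = q y" for y
    unfolding T(3) q_def
    by (rule tlift_sum_set[OF assms(1)])
      (use coord[of y] T in \<open>auto simp: bilinear_on_def linear_on_def scale_right_distrib
        scale_left_distrib mult.commute\<close>)
  hence left: "q y \<in> R_left s C R" for y unfolding R_left_def
    by (intro CollectI exI[of _ "\<lambda>x. ?r x y"] conjI coord) (simp add: lft)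
  have qC: "q y \<in> C" for y unfolding q_def
    by (intro subspace_sum[OF sub] subspace_scale[OF sub]) (use T in auto)
  have "R = (\<Sum>i<n. \<Sum>y\<in>Y. tscale (?r (w i) y) (tpure s C s C (v i) y))"
    unfolding T(3)
  proof (intro sum.cong refl)
    fix i assume i: "i \<in> {..<n}"
    show "tpure s C s C (v i) (w i) = (\<Sum>y\<in>Y. tscale (?r (w i) y) (tpure s C s C (v i) y))"
      by (subst w) (use i T YB B in \<open>auto intro!: linear_on_sum[OF assms(1) vector_space_tscale sub] bil\<close>)
  qed
  also have "\<dots> = (\<Sum>y\<in>Y. \<Sum>i<n. tscale (?r (w i) y) (tpure s C s C (v i) y))"
    by (rule sum.swap)
  also have "\<dots> = (\<Sum>y\<in>Y. tpure s C s C (q y) y)"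
    unfolding q_def by (intro sum.cong refl linear_on_sum[symmetric, OF assms(1) vector_space_tscale sub] bil)
      (use YB B T in auto)
  finally show ?thesis using that[of Y q] fin YB B qC left by blast
qed

lemma R_left_subset:
  assumes "vector_space s" "module.subspace s C" "R \<in> tspace s C s C"
  shows "R_left s C R \<subseteq> C"
proof
  interpret vector_space s by fact
  fix x assume "x \<in> R_left s C R"
  then obtain \<xi> where \<xi>: "x = tlift s C s C (\<lambda>x y. s (\<xi> y) x) R" "linear_on s C (*) \<xi>"
    unfolding R_left_def by blast
  show "x \<in> C" unfolding \<xi>(1)
    by (rule tlift_in_subspace[OF assms(1) _ _ assms(2,3)])
      (use \<xi>(2) subspace_scale[OF assms(2)] in \<open>auto simp: bilinear_on_def linear_on_def
        scale_right_distrib scale_left_distrib mult.commute\<close>)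
qed

section \<open>Coassociativity and the antipode\<close>

context hopf_algebra_on
begin

text \<open>This makes \<open>\<Sum> g h\<^sub>1 h\<^sub>2 h\<^sub>3\<close> meaningful: a trilinear \<open>g\<close> induces a linear map \<open>G\<close> on the triple
  tensor product, and applying \<open>G\<close> to both sides of the coassociativity axiom gives the two ways of
  iterating the comultiplication.\<close>

lemma coassoc_trilinear:
  fixes g :: "'v \<Rightarrow> 'v \<Rightarrow> 'v \<Rightarrow> 'u::ab_group_add"
  assumes U: "vector_space sU"
    and g1: "\<And>q r. q \<in> C \<Longrightarrow> r \<in> C \<Longrightarrow> linear_on s C sU (\<lambda>p. g p q r)"
    and g2: "\<And>p r. p \<in> C \<Longrightarrow> r \<in> C \<Longrightarrow> linear_on s C sU (\<lambda>q. g p q r)"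
    and g3: "\<And>p q. p \<in> C \<Longrightarrow> q \<in> C \<Longrightarrow> linear_on s C sU (\<lambda>r. g p q r)"
    and x: "x \<in> C"
  shows "tlift s C s C (\<lambda>u v. tlift s C s C (\<lambda>p q. g p q v) (\<Delta> u)) (\<Delta> x) =
    tlift s C s C (\<lambda>u v. tlift s C s C (\<lambda>q r. g u q r) (\<Delta> v)) (\<Delta> x)"
proof -
  let ?TT = "tspace s C s C" and ?pure = "tpure s C s C" and ?pure3 = "tpure3 s C"
  let ?TTT = "tspace tscale ?TT s C"
  note vs = vector_space_axioms and subT = subspace_tspace[OF vector_space_axioms subspace_C, of s C]
  note vsT = vector_space_tscale
  note subTT = subspace_tspace[OF vsT subT, of s C]
  note vsTT = vector_space_tscale[where 'v = "('k, 'v, 'v) tensor" and 'w = 'v]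
  have p12: "bilinear_on s C s C tscale ?pure" by (rule bilinear_tpure)
  have p: "bilinear_on tscale ?TT s C tscale (tpure tscale ?TT s C)" by (rule bilinear_tpure)
  have pT: "?pure a b \<in> ?TT" if "a \<in> C" "b \<in> C" for a b by (rule tpure_in_tspace[OF that])
  have p3T: "?pure3 a b c \<in> ?TTT" if "a \<in> C" "b \<in> C" "c \<in> C" for a b c
    unfolding tpure3_def by (intro tpure_in_tspace that)
  have t1: "linear_on s C tscale (\<lambda>a. ?pure3 a b c)" if "b \<in> C" "c \<in> C" for b c
    unfolding tpure3_def
    by (rule linear_on_compose[OF bilinear_onD(1)[OF p12 that(1)] _ bilinear_onD(1)[OF p that(2)]])
      (use pT that in auto)
  have t2: "linear_on s C tscale (\<lambda>b. ?pure3 a b c)" if "a \<in> C" "c \<in> C" for a c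
    unfolding tpure3_def
    by (rule linear_on_compose[OF bilinear_onD(2)[OF p12 that(1)] _ bilinear_onD(1)[OF p that(2)]])
      (use pT that in auto)
  have t3: "linear_on s C tscale (\<lambda>c. ?pure3 a b c)" if "a \<in> C" "b \<in> C" for a b
    unfolding tpure3_def by (rule bilinear_onD(2)[OF p pT[OF that]])
  define G where "G = tlift tscale ?TT s C (\<lambda>T r. tlift s C s C (\<lambda>p q. g p q r) T)"
  have bilG: "bilinear_on tscale ?TT s C sU (\<lambda>T r. tlift s C s C (\<lambda>p q. g p q r) T)"
  proof (rule bilinear_onI)
    fix r assume "r \<in> C"
    show "linear_on tscale ?TT sU (\<lambda>T. tlift s C s C (\<lambda>p q. g p q r) T)"
      by (intro tlift_linear vs subspace_C U bilinear_onI g1 g2 \<open>r \<in> C\<close>)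
  next
    fix T assume "T \<in> ?TT"
    show "linear_on s C sU (\<lambda>r. tlift s C s C (\<lambda>p q. g p q r) T)"
      by (intro tlift_linear_parameter[OF U] vs subspace_C bilinear_onI g1 g2 g3 \<open>T \<in> ?TT\<close>)
  qed
  have linG: "linear_on tscale ?TTT sU G"
    unfolding G_def by (intro tlift_linear vsT subT U bilG)
  have G: "G (?pure3 a b c) = g a b c" if "a \<in> C" "b \<in> C" "c \<in> C" for a b c
  proof -
    have "G (?pure3 a b c) = tlift s C s C (\<lambda>p q. g p q c) (?pure a b)"
      unfolding G_def tpure3_def by (rule tlift_tpure[OF U bilG pT[OF that(1,2)] that(3)])
    also have "\<dots> = g a b c" by (rule tlift_tpure[OF U]) (intro bilinear_onI g1 g2 that, use that in auto)
    finally show ?thesis .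
  qed
  have DT: "\<Delta> u \<in> ?TT" if "u \<in> C" for u by (rule comul_closed[OF that])
  have Dim: "\<Delta> ` C \<subseteq> ?TT" using DT by auto
  have b12: "bilinear_on s C s C tscale (\<lambda>p q. ?pure3 p q c)" if "c \<in> C" for c
    by (intro bilinear_onI t1 t2 that)
  have b23: "bilinear_on s C s C tscale (\<lambda>q r. ?pure3 a q r)" if "a \<in> C" for a
    by (intro bilinear_onI t2 t3 that)
  have in12: "tlift s C s C (\<lambda>p q. ?pure3 p q c) (\<Delta> u) \<in> ?TTT"
    and G12: "G (tlift s C s C (\<lambda>p q. ?pure3 p q c) (\<Delta> u)) = tlift s C s C (\<lambda>p q. g p q c) (\<Delta> u)"
    if "c \<in> C" "u \<in> C" for c u
  proof -
    from DT[OF that(2)] show "tlift s C s C (\<lambda>p q. ?pure3 p q c) (\<Delta> u) \<in> ?TTT"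
      by (intro tlift_in_subspace[OF vsTT b12 _ subTT]) (use that p3T in auto)
    show "G (tlift s C s C (\<lambda>p q. ?pure3 p q c) (\<Delta> u)) = tlift s C s C (\<lambda>p q. g p q c) (\<Delta> u)"
      by (subst linear_tlift[OF vsTT U b12 _ subTT linG DT])
        (use that p3T G in \<open>auto intro!: tlift_cong\<close>)
  qed
  have in23: "tlift s C s C (\<lambda>q r. ?pure3 a q r) (\<Delta> v) \<in> ?TTT"
    and G23: "G (tlift s C s C (\<lambda>q r. ?pure3 a q r) (\<Delta> v)) = tlift s C s C (\<lambda>q r. g a q r) (\<Delta> v)"
    if "a \<in> C" "v \<in> C" for a v
  proof -
    from DT[OF that(2)] show "tlift s C s C (\<lambda>q r. ?pure3 a q r) (\<Delta> v) \<in> ?TTT"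
      by (intro tlift_in_subspace[OF vsTT b23 _ subTT]) (use that p3T in auto)
    show "G (tlift s C s C (\<lambda>q r. ?pure3 a q r) (\<Delta> v)) = tlift s C s C (\<lambda>q r. g a q r) (\<Delta> v)"
      by (subst linear_tlift[OF vsTT U b23 _ subTT linG DT])
        (use that p3T G in \<open>auto intro!: tlift_cong\<close>)
  qed
  have bil1: "bilinear_on s C s C tscale (\<lambda>u v. tlift s C s C (\<lambda>p q. ?pure3 p q v) (\<Delta> u))"
  proof (rule bilinear_onI)
    fix v assume "v \<in> C"
    show "linear_on s C tscale (\<lambda>u. tlift s C s C (\<lambda>p q. ?pure3 p q v) (\<Delta> u))"
      by (rule linear_on_compose[OF comul_linear Dim])
        (intro tlift_linear vs subspace_C vsTT b12 \<open>v \<in> C\<close>)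
  next
    fix u assume "u \<in> C"
    show "linear_on s C tscale (\<lambda>v. tlift s C s C (\<lambda>p q. ?pure3 p q v) (\<Delta> u))"
      by (intro tlift_linear_parameter[OF vsTT] vs subspace_C b12 t3 DT \<open>u \<in> C\<close>)
  qed
  have bil2: "bilinear_on s C s C tscale (\<lambda>u v. tlift s C s C (\<lambda>q r. ?pure3 u q r) (\<Delta> v))"
  proof (rule bilinear_onI)
    fix v assume "v \<in> C"
    show "linear_on s C tscale (\<lambda>u. tlift s C s C (\<lambda>q r. ?pure3 u q r) (\<Delta> v))"
      by (intro tlift_linear_parameter[OF vsTT] vs subspace_C b23 t1 DT \<open>v \<in> C\<close>)
  next
    fix u assume "u \<in> C"
    show "linear_on s C tscale (\<lambda>v. tlift s C s C (\<lambda>q r. ?pure3 u q r) (\<Delta> v))"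
      by (rule linear_on_compose[OF comul_linear Dim])
        (intro tlift_linear vs subspace_C vsTT b23 \<open>u \<in> C\<close>)
  qed
  have "G (comul_id s C \<Delta> (\<Delta> x)) =
      tlift s C s C (\<lambda>u v. tlift s C s C (\<lambda>p q. g p q v) (\<Delta> u)) (\<Delta> x)"
    unfolding comul_id_def
    by (subst linear_tlift[OF vsTT U bil1 in12 subTT linG DT[OF x]])
      (auto intro!: tlift_cong simp: G12)
  moreover have "G (id_comul s C \<Delta> (\<Delta> x)) =
      tlift s C s C (\<lambda>u v. tlift s C s C (\<lambda>q r. g u q r) (\<Delta> v)) (\<Delta> x)"
    unfolding id_comul_def
    by (subst linear_tlift[OF vsTT U bil2 in23 subTT linG DT[OF x]])
      (auto intro!: tlift_cong simp: G23)
  ultimately show ?thesis by (simp add: coassoc[OF x])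
qed

end

lemma algebra_scale_mult:
  fixes sA :: "'k::field \<Rightarrow> 'a::ring_1 \<Rightarrow> 'a"
  assumes "algebra_on sA UNIV (*) 1"
  shows "sA c x * y = sA c (x * y)" "x * sA c y = sA c (x * y)"
  using algebra_on.mult_bilinear[OF assms] by (auto simp: bilinear_on_def linear_on_def)

context module_algebra
begin

lemmas scale_mult = algebra_scale_mult[OF A.algebra_on_axioms]

lemma act_linear:
  shows "linear_on s C sA (\<lambda>h. act h a)" "h \<in> C \<Longrightarrow> linear_on sA UNIV sA (act h)"
  using act_bilinear by (auto simp: bilinear_on_def)

lemma mult_linear:
  shows "linear_on sA UNIV sA (\<lambda>x. a * x)" "linear_on sA UNIV sA (\<lambda>x. x * a)"
  by (auto simp: linear_on_def scale_mult algebra_simps)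

text \<open>In Sweedler notation \<open>(h b) c = \<Sum> (h\<^sub>1 b) (h\<^sub>2 S(h\<^sub>3) c) = \<Sum> h\<^sub>1 (b (S(h\<^sub>2) c))\<close>. It moves the action of
  \<open>h\<close> from the first factor of a product to the outside, which is what makes the relations in
  \<open>End_H_left_independent\<close> stable under \<open>H\<close>.\<close>

lemma act_times_via_antipode:
  assumes h: "h \<in> C"
  shows "act h b * c = tlift s C s C (\<lambda>u v. act u (b * act (S v) c)) (\<Delta> h)"
proof -
  note vsA = A.vector_space_axioms and vs = H.vector_space_axioms
  define g where "g = (\<lambda>p q r. act p b * act q (act (S r) c))"
  have lin1: "linear_on s C sA (\<lambda>p. g p q r)" for q r
    unfolding g_def by (rule linear_on_compose[OF act_linear(1) _ mult_linear(2)]) auto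
  have lin2: "linear_on s C sA (\<lambda>q. g p q r)" for p r
    unfolding g_def by (rule linear_on_compose[OF act_linear(1) _ mult_linear(1)]) auto
  have lin3: "linear_on s C sA (\<lambda>r. g p q r)" if "q \<in> C" for p q
  proof -
    have "linear_on s C sA (\<lambda>r. act (S r) c)"
      by (rule linear_on_compose[OF H.antipode_linear _ act_linear(1)]) (auto simp: H.antipode_closed)
    hence "linear_on s C sA (\<lambda>r. act q (act (S r) c))"
      by (rule linear_on_compose[OF _ _ act_linear(2)[OF that]]) auto
    thus ?thesis unfolding g_def by (rule linear_on_compose[OF _ _ mult_linear(1)]) auto
  qed
  have bilS: "bilinear_on s C s C s (\<lambda>q r. mult q (S r))"
    by (intro bilinear_onI linear_on_compose[OF H.antipode_linear _ bilinear_onD(2)[OF H.mult_bilinear]]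
      bilinear_onD(1)[OF H.mult_bilinear]) (auto simp: H.antipode_closed)
  have inner: "tlift s C s C (\<lambda>q r. g u q r) (\<Delta> v) = act (s (\<epsilon> v) u) b * c"
    if u: "u \<in> C" and v: "v \<in> C" for u v
  proof -
    define L where "L = (\<lambda>z. act u b * act z c)"
    have L: "linear_on s C sA L" unfolding L_def
      by (rule linear_on_compose[OF act_linear(1) _ mult_linear(1)]) auto
    have "tlift s C s C (\<lambda>q r. g u q r) (\<Delta> v) = tlift s C s C (\<lambda>q r. L (mult q (S r))) (\<Delta> v)"
      by (rule tlift_cong) (simp add: g_def L_def act_mult H.antipode_closed)
    also have "\<dots> = L (tlift s C s C (\<lambda>q r. mult q (S r)) (\<Delta> v))"
      by (rule linear_tlift[symmetric, OF vs vsA bilS _ H.subspace_C L H.comul_closed[OF v]])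
        (auto simp: H.mult_closed H.antipode_closed)
    also have "\<dots> = sA (\<epsilon> v) (act u b * c)"
      using act_linear(1)[of c] by (simp add: H.antipode_right[OF v] L_def linear_on_def
        H.unit_closed act_unit scale_mult)
    also have "\<dots> = act (s (\<epsilon> v) u) b * c"
      using act_linear(1)[of b] u by (simp add: linear_on_def scale_mult)
    finally show ?thesis .
  qed
  have bilE: "bilinear_on s C s C s (\<lambda>u v. s (\<epsilon> v) u)"
    using H.counit_linear by (intro bilinear_onI) (auto simp: linear_on_def algebra_simps
      H.scale_right_distrib H.scale_left_distrib)
  define M where "M = (\<lambda>z. act z b * c)"
  have M: "linear_on s C sA M" unfolding M_def
    by (rule linear_on_compose[OF act_linear(1) _ mult_linear(2)]) auto
  have "tlift s C s C (\<lambda>u v. act u (b * act (S v) c)) (\<Delta> h) =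
      tlift s C s C (\<lambda>u v. tlift s C s C (\<lambda>p q. g p q v) (\<Delta> u)) (\<Delta> h)"
    by (rule tlift_cong) (simp add: g_def act_prod)
  also have "\<dots> = tlift s C s C (\<lambda>u v. tlift s C s C (\<lambda>q r. g u q r) (\<Delta> v)) (\<Delta> h)"
    by (rule H.coassoc_trilinear[OF vsA lin1 lin2 lin3 h])
  also have "\<dots> = tlift s C s C (\<lambda>u v. M (s (\<epsilon> v) u)) (\<Delta> h)"
    by (rule tlift_cong) (simp add: inner M_def)
  also have "\<dots> = M (tlift s C s C (\<lambda>u v. s (\<epsilon> v) u) (\<Delta> h))"
    by (rule linear_tlift[symmetric, OF vs vsA bilE _ H.subspace_C M H.comul_closed[OF h]])
      (auto intro: H.subspace_scale[OF H.subspace_C])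
  also have "\<dots> = act h b * c" by (simp add: H.counit_right[OF h] M_def)
  finally show ?thesis by simp
qed

section \<open>Galois module algebras\<close>

lemma galois_expansion:
  assumes "galois s C sA act" "f \<in> End sA"
  obtains n :: nat and a h where "h ` {..<n} \<subseteq> C" "\<And>x. f x = (\<Sum>i<n. a i * act (h i) x)"
proof -
  let ?g = "\<lambda>a h b. a * act h b"
  have "f \<in> tlift sA UNIV s C ?g ` tspace sA UNIV s C"
    using assms by (simp add: galois_def bij_betw_def)
  then obtain T where T: "T \<in> tspace sA UNIV s C" "f = tlift sA UNIV s C ?g T" by blast
  obtain n :: nat and a h where *: "\<And>i. i < n \<Longrightarrow> h i \<in> C" "T = (\<Sum>i<n. tpure sA UNIV s C (a i) (h i))"
    using T(1) by (rule tspaceE) blast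
  have bil: "bilinear_on sA UNIV s C (fun_scale sA) ?g"
    using act_linear(1) by (intro bilinear_onI) 
      (auto simp: linear_on_def fun_eq_iff fun_scale_def scale_mult algebra_simps)
  have "f = (\<Sum>i<n. ?g (a i) (h i))"
    unfolding T(2) *(2)
    by (rule tlift_sum_set[OF vector_space_fun_scale[OF A.vector_space_axioms] bil]) (use * in auto)
  hence "f x = (\<Sum>i<n. a i * act (h i) x)" for x by (simp add: sum_apply)
  thus ?thesis using that[of h n a] *(1) by auto
qed

text \<open>An endomorphism \<open>x \<mapsto> \<Sum>\<^sub>i a\<^sub>i (h\<^sub>i x)\<close> maps every \<open>x\<close> into \<open>V \<cdot> (H x)\<close>, where \<open>V\<close> is the fixed finite dimensional
  space spanned by the \<open>a\<^sub>i\<close>. Since \<open>H x\<close> has finite dimension as well, \<open>finite_basis_if_endomorphisms_confined\<close> applies.\<close>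

lemma galois_finite_basis:
  assumes "galois s C sA act" "finite_dim_on s C" and B: "A.independent B" "A.span B = UNIV"
  shows "finite B"
proof -
  obtain G where G: "finite G" "H.span G = C" using assms(2) unfolding finite_dim_on_def by blast
  let ?W = "\<lambda>v x. (\<lambda>g. v * act g x) ` G"
  show ?thesis
  proof (rule A.finite_basis_if_endomorphisms_confined[OF B])
    show "finite (?W v x)" for v x using G by simp
    fix f assume "Vector_Spaces.linear sA sA f"
    hence "f \<in> End sA" by (simp add: End_def)
    then obtain n :: nat and a h where f: "h ` {..<n} \<subseteq> C" "\<And>x. f x = (\<Sum>i<n. a i * act (h i) x)"
      by (rule galois_expansion[OF assms(1)]) blast
    obtain V where V: "finite V" "V \<subseteq> B" "a ` {..<n} \<subseteq> A.span V"
      by (rule A.finite_subset_span[of "a ` {..<n}" B]) (auto simp: B)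
    have "f x \<in> A.span (\<Union>v\<in>V. ?W v x)" for x
      unfolding f(2)
    proof (rule A.span_sum)
      fix i assume i: "i \<in> {..<n}"
      have bil: "bilinear_on sA UNIV s C sA (\<lambda>a g. a * act g x)"
        using act_linear(1) by (intro bilinear_onI) (auto simp: linear_on_def scale_mult algebra_simps)
      have "a i * act (h i) x \<in> A.span ((\<lambda>(p, q). p * act q x) ` (V \<times> G))"
        by (rule bilinear_on_span[OF A.vector_space_axioms H.vector_space_axioms A.vector_space_axioms
          A.subspace_UNIV H.subspace_C bil]) (use V f i G H.span_superset[of G] in auto)
      also have "(\<lambda>(p, q). p * act q x) ` (V \<times> G) = (\<Union>v\<in>V. ?W v x)" by auto
      finally show "a i * act (h i) x \<in> A.span (\<Union>v\<in>V. ?W v x)" .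
    qed
    with V show "\<exists>V. finite V \<and> V \<subseteq> B \<and> (\<forall>x. f x \<in> A.span (\<Union>v\<in>V. ?W v x))" by blast
  qed
qed

text \<open>Linear independence over \<open>k\<close> of \<open>H\<close>-linear endomorphisms implies linear independence over \<open>A\<close>. The
  coefficient vectors \<open>a\<close> of relations \<open>\<Sum>\<^sub>\<phi> a\<^sub>\<phi> \<phi> = 0\<close> are stable under left multiplication by \<open>A\<close> and under \<open>H\<close>,
  hence under all of \<open>End A\<close> by the Galois property. An endomorphism of the form \<open>x \<mapsto> \<xi>(x) 1\<close> then turns a
  nontrivial relation into one with scalar coefficients.\<close>

lemma End_H_left_independent:
  assumes gal: "galois s C sA act" and P: "finite P" "P \<subseteq> End_H C sA act"
    and indep: "\<not> module.dependent (fun_scale sA) P"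
    and rel: "\<And>x. (\<Sum>\<phi>\<in>P. a \<phi> * \<phi> x) = 0" and "\<psi> \<in> P"
  shows "a \<psi> = 0"
proof (rule ccontr)
  assume nz: "a \<psi> \<noteq> 0"
  interpret F: vector_space "fun_scale sA" by (rule vector_space_fun_scale) (rule A.vector_space_axioms)
  note vsA = A.vector_space_axioms
  have comm: "\<phi> (act h x) = act h (\<phi> x)" if "\<phi> \<in> P" "h \<in> C" for \<phi> h x
    using P(2) that by (auto simp: End_H_def)
  have act_rel: "(\<Sum>\<phi>\<in>P. act h (a \<phi>) * \<phi> x) = 0" if h: "h \<in> C" for h x
  proof -
    have bil: "bilinear_on s C s C sA (\<lambda>u v. act u (b * act (S v) c))" for b c
    proof (rule bilinear_onI)
      fix u assume u: "u \<in> C"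
      have "linear_on s C sA (\<lambda>v. act (S v) c)"
        by (rule linear_on_compose[OF H.antipode_linear _ act_linear(1)]) (auto simp: H.antipode_closed)
      hence "linear_on s C sA (\<lambda>v. b * act (S v) c)"
        by (rule linear_on_compose[OF _ _ mult_linear(1)]) auto
      thus "linear_on s C sA (\<lambda>v. act u (b * act (S v) c))"
        by (rule linear_on_compose[OF _ _ act_linear(2)[OF u]]) auto
    qed (rule act_linear)
    obtain n :: nat and u v where D: "\<And>i. i < n \<Longrightarrow> u i \<in> C" "\<And>i. i < n \<Longrightarrow> v i \<in> C"
      "\<Delta> h = (\<Sum>i<n. tpure s C s C (u i) (v i))"
      using H.comul_closed[OF h] by (rule tspaceE) blast
    have "(\<Sum>\<phi>\<in>P. act h (a \<phi>) * \<phi> x) = (\<Sum>\<phi>\<in>P. \<Sum>i<n. act (u i) (a \<phi> * act (S (v i)) (\<phi> x)))"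
      unfolding act_times_via_antipode[OF h] D(3)
      by (subst tlift_sum_set[OF vsA bil]) (use D in auto)
    also have "\<dots> = (\<Sum>i<n. \<Sum>\<phi>\<in>P. act (u i) (a \<phi> * \<phi> (act (S (v i)) x)))"
      by (subst sum.swap) (use D H.antipode_closed comm in \<open>auto intro!: sum.cong\<close>)
    also have "\<dots> = (\<Sum>i<n. act (u i) (\<Sum>\<phi>\<in>P. a \<phi> * \<phi> (act (S (v i)) x)))"
    proof (intro sum.cong refl)
      fix i assume "i \<in> {..<n}"
      hence "linear_on sA UNIV sA (act (u i))" using D by (intro act_linear) auto
      from linear_on_sum[OF vsA vsA A.subspace_UNIV this, of P _ "\<lambda>_. 1"]
      show "(\<Sum>\<phi>\<in>P. act (u i) (a \<phi> * \<phi> (act (S (v i)) x))) =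
          act (u i) (\<Sum>\<phi>\<in>P. a \<phi> * \<phi> (act (S (v i)) x))" by simp
    qed
    also have "\<dots> = 0"
    proof (intro sum.neutral ballI)
      fix i assume "i \<in> {..<n}"
      hence "linear_on sA UNIV sA (act (u i))" using D by (intro act_linear) auto
      from linear_on_sum[OF vsA vsA A.subspace_UNIV this, of "{}"]
      show "act (u i) (\<Sum>\<phi>\<in>P. a \<phi> * \<phi> (act (S (v i)) x)) = 0" by (simp add: rel)
    qed
    finally show ?thesis .
  qed
  have End_rel: "(\<Sum>\<phi>\<in>P. f (a \<phi>) * \<phi> x) = 0" if fE: "f \<in> End sA" for f x
  proof -
    obtain n :: nat and b h where f: "h ` {..<n} \<subseteq> C" "\<And>x. f x = (\<Sum>i<n. b i * act (h i) x)"
      using fE by (rule galois_expansion[OF gal]) blast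
    have "(\<Sum>\<phi>\<in>P. f (a \<phi>) * \<phi> x) = (\<Sum>i<n. b i * (\<Sum>\<phi>\<in>P. act (h i) (a \<phi>) * \<phi> x))"
      unfolding f(2) sum_distrib_right sum_distrib_left by (subst sum.swap) (simp add: mult.assoc)
    thus ?thesis using f(1) by (simp add: act_rel image_subset_iff)
  qed
  obtain \<xi> where \<xi>: "Vector_Spaces.linear sA (*) \<xi>" "\<xi> (a \<psi>) = 1"
    by (rule A.linear_functional_one[OF nz])
  interpret X: Vector_Spaces.linear sA "(*)" \<xi> by (rule \<xi>(1))
  define f where "f = (\<lambda>x. sA (\<xi> x) 1)"
  have "f \<in> End sA" unfolding End_def f_def mem_Collect_eq Vector_Spaces.linear_def
    by (intro conjI vsA) (unfold_locales, auto simp: X.add X.scale A.scale_left_distrib)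
  from End_rel[OF this] have "(\<Sum>\<phi>\<in>P. sA (\<xi> (a \<phi>)) (\<phi> x)) = 0" for x
    by (simp add: f_def scale_mult)
  hence "(\<Sum>\<phi>\<in>P. fun_scale sA (\<xi> (a \<phi>)) \<phi>) = 0"
    by (simp add: fun_eq_iff sum_apply fun_scale_def)
  from F.independentD[OF indep P(1) order_refl this \<open>\<psi> \<in> P\<close>] \<xi>(2) show False by simp
qed

end

section \<open>Central simple algebras\<close>

text \<open>This is the injectivity of \<open>A \<otimes> A\<^sup>o\<^sup>p \<rightarrow> End A\<close>. The relations form a bimodule, so the coefficients
  occurring at a fixed \<open>b\<close> form a two-sided ideal. If it is everything, some relation has coefficient
  \<open>1\<close> at \<open>b\<close>; its commutators with elements of \<open>A\<close> are relations without \<open>b\<close> and vanish by induction, so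
  all its coefficients are central, that is, scalars, and \<open>B\<close> would be dependent.\<close>

lemma central_simple_two_sided_independent:
  fixes sA :: "'k::field \<Rightarrow> 'a::ring_1 \<Rightarrow> 'a"
  assumes alg: "algebra_on sA UNIV (*) 1" and cs: "central_simple sA"
    and "finite B" "\<not> module.dependent sA B" "\<And>x. (\<Sum>b\<in>B. a b * x * b) = 0" "b \<in> B"
  shows "a b = 0"
proof -
  interpret A: algebra_on sA UNIV "(*)" 1 by (rule alg)
  have "\<forall>b\<in>B. a b = 0"
    using assms(3-5)
  proof (induction B arbitrary: a rule: finite_induct)
    case empty show ?case by simp
  next
    case (insert b B)
    have indep: "A.independent B" using insert.prems(1) by (rule A.independent_mono) auto
    have sum_insert: "(\<Sum>c\<in>insert b B. f c) = f b + (\<Sum>c\<in>B. f c)" for f :: "'a \<Rightarrow> 'a"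
      using insert.hyps by simp
    define X where "X = {a :: 'a \<Rightarrow> 'a. \<forall>x. (\<Sum>c\<in>insert b B. a c * x * c) = 0}"
    define I where "I = (\<lambda>a. a b) ` X"
    have "two_sided_ideal I"
      unfolding two_sided_ideal_def
    proof (intro conjI ballI allI)
      have "(\<lambda>_. 0) \<in> X" by (simp add: X_def)
      thus "0 \<in> I" unfolding I_def by force
    next
      fix p q assume "p \<in> I" "q \<in> I"
      then obtain a a' where "a \<in> X" "a' \<in> X" "p = a b" "q = a' b" by (auto simp: I_def)
      moreover from this have "(\<lambda>c. a c + a' c) \<in> X"
        by (simp add: X_def distrib_right sum.distrib del: sum.insert)
      ultimately show "p + q \<in> I" unfolding I_def by force
    next
      fix p r assume "p \<in> I"
      then obtain a where a: "a \<in> X" "p = a b" by (auto simp: I_def)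
      hence z: "(\<Sum>c\<in>insert b B. a c * x * c) = 0" for x unfolding X_def by blast
      have "(\<lambda>c. r * a c) \<in> X"
        using z by (simp add: X_def mult.assoc sum_distrib_left[symmetric] del: sum.insert)
      thus "r * p \<in> I" unfolding I_def a(2) by force
      \<comment> \<open>The factor \<open>r\<close> can be absorbed into the variable \<open>x\<close> of the relation.\<close>
      have "(\<lambda>c. a c * r) \<in> X"
        using z[of "r * x" for x] by (simp add: X_def mult.assoc del: sum.insert)
      thus "p * r \<in> I" unfolding I_def a(2) by force
    qed
    hence cases: "I = {0} \<or> I = UNIV" using cs by (simp add: central_simple_def)
    have zero: "\<forall>c\<in>B. a' c = 0" if "a' \<in> X" "a' b = 0" for a'
      by (rule insert.IH[OF indep]) (use that in \<open>auto simp: X_def sum_insert simp del: sum.insert\<close>)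
    have "I \<noteq> UNIV"
    proof
      assume "I = UNIV"
      hence "1 \<in> I" by simp
      then obtain e where e: "e \<in> X" "e b = 1" unfolding I_def by force
      hence z: "(\<Sum>c\<in>insert b B. e c * x * c) = 0" for x unfolding X_def by blast
      have "\<exists>l. e c = sA l 1" if "c \<in> insert b B" for c
      proof -
        have "r * e c = e c * r" for r
        proof -
          have "(\<Sum>c\<in>insert b B. (r * e c - e c * r) * x * c) =
              r * (\<Sum>c\<in>insert b B. e c * x * c) - (\<Sum>c\<in>insert b B. e c * (r * x) * c)" for x
            by (simp add: sum_distrib_left sum_subtractf left_diff_distrib mult.assoc del: sum.insert)
          hence "(\<lambda>c. r * e c - e c * r) \<in> X" by (simp add: X_def z del: sum.insert)
          from zero[OF this] e(2) that show ?thesis by auto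
        qed
        hence "e c \<in> {z. \<forall>a. z * a = a * z}" by simp
        also have "\<dots> = range (\<lambda>l. sA l 1)" using cs by (simp add: central_simple_def)
        finally show ?thesis by auto
      qed
      then obtain l where l: "\<And>c. c \<in> insert b B \<Longrightarrow> e c = sA (l c) 1" by metis
      have "(\<Sum>c\<in>insert b B. sA (l c) c) = (\<Sum>c\<in>insert b B. e c * 1 * c)"
        by (intro sum.cong refl) (simp add: l algebra_scale_mult[OF alg])
      hence "(\<Sum>c\<in>insert b B. sA (l c) c) = 0" using z[of 1] by simp
      from A.independentD[OF insert.prems(1) _ order_refl this, of b] insert.hyps
      have "l b = 0" by simp
      with l[of b] e(2) A.unit_nonzero show False by simp
    qed
    with cases have "I = {0}" by blast
    moreover have aX: "a \<in> X" using insert.prems(2) unfolding X_def by blast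
    ultimately have "a b = 0" unfolding I_def by blast
    with zero[OF aX] show ?case by simp
  qed
  thus ?thesis using assms(6) by blast
qed

section \<open>The two dimension counts\<close>

context module_algebra
begin

text \<open>By \<open>End_H_left_independent\<close>, \<open>A \<otimes> span P\<close> embeds into \<open>End A\<close>, whose dimension is the square of \<open>dim A\<close>.\<close>

lemma card_independent_End_H_le:
  assumes gal: "galois s C sA act" and B: "finite B" "A.independent B" "A.span B = UNIV"
    and P: "finite P" "P \<subseteq> End_H C sA act" "\<not> module.dependent (fun_scale sA) P"
  shows "card P \<le> card B"
proof -
  interpret F: vector_space "fun_scale sA" by (rule vector_space_fun_scale) (rule A.vector_space_axioms)
  obtain T where T: "finite T" "card T \<le> card B * card B" "End sA \<subseteq> F.span T"
    by (rule endomorphisms_span[OF A.vector_space_axioms B])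
  define f where "f = (\<lambda>(b, \<phi>) (x :: 'a). b * \<phi> x :: 'a)"
  have "card (B \<times> P) \<le> card T"
  proof (rule F.independent_family_card_le)
    show "finite (B \<times> P)" using B P by simp
    show "finite T" by fact
    show "f ` (B \<times> P) \<subseteq> F.span T"
    proof (rule order_trans[OF _ T(3)], clarify)
      fix b \<phi> assume "\<phi> \<in> P"
      hence "Vector_Spaces.linear sA sA \<phi>" using P(2) by (auto simp: End_H_def End_def)
      then interpret p: Vector_Spaces.linear sA sA \<phi> .
      show "f (b, \<phi>) \<in> End sA" unfolding End_def f_def mem_Collect_eq Vector_Spaces.linear_def
        by (intro conjI A.vector_space_axioms)
          (unfold_locales, auto simp: p.add p.scale scale_mult algebra_simps)
    qed
  next
    fix c assume c: "(\<Sum>i\<in>B \<times> P. fun_scale sA (c i) (f i)) = 0"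
    have rel: "(\<Sum>\<phi>\<in>P. (\<Sum>b\<in>B. sA (c (b, \<phi>)) b) * \<phi> x) = 0" for x
    proof -
      have "(\<Sum>i\<in>B \<times> P. fun_scale sA (c i) (f i)) x = 0" using c by simp
      hence "(\<Sum>b\<in>B. \<Sum>\<phi>\<in>P. sA (c (b, \<phi>)) (b * \<phi> x)) = 0"
        by (simp add: sum_apply fun_scale_def f_def sum.cartesian_product')
      thus ?thesis by (subst (asm) sum.swap) (simp add: sum_distrib_right scale_mult)
    qed
    have "(\<Sum>b\<in>B. sA (c (b, \<phi>)) b) = 0" if "\<phi> \<in> P" for \<phi>
      by (rule End_H_left_independent[OF gal P rel that])
    from A.independentD[OF B(2,1) order_refl this] show "\<forall>i\<in>B \<times> P. c i = 0" by auto
  qed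
  with T(2) have "card B * card P \<le> card B * card B" unfolding card_cartesian_product by linarith
  moreover have "1 \<in> A.span B" using B(3) by simp
  hence "B \<noteq> {}" using A.unit_nonzero by auto
  ultimately show ?thesis using B(1) by (simp add: card_gt_0_iff)
qed

end

text \<open>The hypothesis says that every right multiplication lies in \<open>A \<cdot> P\<close>, the span of the maps \<open>b \<mapsto> c (p b)\<close>.
  Multiplying on the left, so do all maps \<open>b \<mapsto> c b a\<close>. For central simple \<open>A\<close> these include \<open>(dim A)\<^sup>2\<close>
  independent ones, whereas \<open>A \<cdot> P\<close> has dimension at most \<open>dim A * card P\<close>.\<close>

lemma central_simple_card_le:
  fixes sA :: "'k::field \<Rightarrow> 'a::ring_1 \<Rightarrow> 'a"
  assumes alg: "algebra_on sA UNIV (*) 1" and cs: "central_simple sA"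
    and B: "finite B" "\<not> module.dependent sA B" "module.span sA B = UNIV" and P: "finite P"
    and opp: "\<And>a. \<exists>Y y q. finite Y \<and> (\<forall>i\<in>Y. q i \<in> module.span (fun_scale sA) P) \<and>
      (\<forall>b. b * a = (\<Sum>i\<in>Y. y i * q i b))"
  shows "card B \<le> card P"
proof -
  interpret A: algebra_on sA UNIV "(*)" 1 by (rule alg)
  note vsA = A.vector_space_axioms note vsF = vector_space_fun_scale[OF vsA]
  interpret F: vector_space "fun_scale sA" by (rule vsF)
  note scale_mult = algebra_scale_mult[OF alg]
  define f where "f = (\<lambda>(c, a) b. c * b * a :: 'a)"
  let ?m = "\<lambda>c q. \<lambda>b. c * q b :: 'a"
  let ?T = "(\<lambda>(c, q). ?m c q) ` (B \<times> P)"
  have "card (B \<times> B) \<le> card ?T"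
  proof (rule F.independent_family_card_le)
    show "finite (B \<times> B)" "finite ?T" using B P by auto
    show "f ` (B \<times> B) \<subseteq> F.span ?T"
    proof clarify
      fix c a
      obtain Y :: "'b set" and y q where Y: "finite Y" "\<forall>i\<in>Y. q i \<in> F.span P"
        "\<forall>b. b * a = (\<Sum>i\<in>Y. y i * q i b)" using opp[of a] by blast
      have bil: "bilinear_on sA UNIV (fun_scale sA) UNIV (fun_scale sA) ?m"
        by (intro bilinear_onI linear_onI)
          (auto simp: fun_scale_def scale_mult algebra_simps fun_eq_iff)
      have "f (c, a) = (\<Sum>i\<in>Y. ?m (c * y i) (q i))"
        using Y(3) by (simp add: f_def fun_eq_iff sum_apply mult.assoc sum_distrib_left)
      also have "\<dots> \<in> F.span ?T"
        by (intro F.span_sum bilinear_on_span[OF vsA vsF vsF A.subspace_UNIV F.subspace_UNIV bil])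
          (use Y B in auto)
      finally show "f (c, a) \<in> F.span ?T" .
    qed
  next
    fix c assume c: "(\<Sum>i\<in>B \<times> B. fun_scale sA (c i) (f i)) = 0"
    have rel: "(\<Sum>a\<in>B. (\<Sum>b\<in>B. sA (c (b, a)) b) * x * a) = 0" for x
    proof -
      have "(\<Sum>i\<in>B \<times> B. fun_scale sA (c i) (f i)) x = 0" using c by simp
      hence "(\<Sum>b\<in>B. \<Sum>a\<in>B. sA (c (b, a)) (b * x * a)) = 0"
        by (simp add: sum_apply fun_scale_def f_def sum.cartesian_product')
      thus ?thesis by (subst (asm) sum.swap) (simp add: sum_distrib_right scale_mult)
    qed
    have "(\<Sum>b\<in>B. sA (c (b, a)) b) = 0" if "a \<in> B" for a
      by (rule central_simple_two_sided_independent[OF alg cs B(1,2) rel that])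
    from A.independentD[OF B(2,1) order_refl this] show "\<forall>i\<in>B \<times> B. c i = 0" by auto
  qed
  also have "\<dots> \<le> card B * card P"
    using card_image_le[of "B \<times> P"] B P by (metis card_cartesian_product finite_cartesian_product)
  finally have "card B * card B \<le> card B * card P" unfolding card_cartesian_product .
  moreover have "1 \<in> A.span B" using B(3) by simp
  hence "B \<noteq> {}" using A.unit_nonzero by auto
  ultimately show ?thesis using B(1) by (simp add: card_gt_0_iff)
qed

theorem proposition2p3:
  fixes sH :: "'k::field \<Rightarrow> 'h::ring_1 \<Rightarrow> 'h"
    and sA :: "'k \<Rightarrow> 'a::ring_1 \<Rightarrow> 'a"
    and \<Delta>H :: "'h \<Rightarrow> ('k, 'h, 'h) tensor" and \<epsilon>H :: "'h \<Rightarrow> 'k" and SH :: "'h \<Rightarrow> 'h"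
    and act :: "'h \<Rightarrow> 'a \<Rightarrow> 'a"
    and \<Delta>E :: "('a \<Rightarrow> 'a) \<Rightarrow> ('k, 'a \<Rightarrow> 'a, 'a \<Rightarrow> 'a) tensor"
    and \<epsilon>E :: "('a \<Rightarrow> 'a) \<Rightarrow> 'k" and SE :: "('a \<Rightarrow> 'a) \<Rightarrow> 'a \<Rightarrow> 'a"
    and R :: "('k, 'h, 'h) tensor" and R' :: "('k, 'a \<Rightarrow> 'a, 'a \<Rightarrow> 'a) tensor"
    and E :: "('a \<Rightarrow> 'a) set" and sE :: "'k \<Rightarrow> ('a \<Rightarrow> 'a) \<Rightarrow> 'a \<Rightarrow> 'a"
  assumes "hopf_algebra_on sH UNIV (*) 1 \<Delta>H \<epsilon>H SH"
    and "finite_dim_on sH (UNIV :: 'h set)"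
    and "module_algebra sH UNIV (*) 1 \<Delta>H \<epsilon>H SH sA act"
    and "galois sH UNIV sA act"
    and "E = End_H UNIV sA act" and "sE = fun_scale sA"
    and "hopf_algebra_on sE E (\<circ>) id \<Delta>E \<epsilon>E SE"
    and "module_algebra sE E (\<circ>) id \<Delta>E \<epsilon>E SE sA (\<lambda>\<phi> a. \<phi> a)"
    and "quasitriangular sH UNIV (*) 1 \<Delta>H \<epsilon>H R"
    and "quasitriangular sE E (\<circ>) id \<Delta>E \<epsilon>E R'"
    and "corresponding sH UNIV act R sE E (\<lambda>\<phi> a. \<phi> a) R'"
    and "central_simple sA"
    and "cocommutative sH UNIV \<Delta>H"
    and "R = tpure sH UNIV sH UNIV 1 1"
  shows "qt_rank sE E R' = vector_space.dim sA (UNIV :: 'a set)"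

proof -
  interpret H: module_algebra sH UNIV "(*)" 1 \<Delta>H \<epsilon>H SH sA act by fact
  interpret E: module_algebra sE E "(\<circ>)" id \<Delta>E \<epsilon>E SE sA "\<lambda>\<phi> a. \<phi> a" by fact
  note vsE = E.H.vector_space_axioms and subE = E.H.subspace_C and vsA = H.A.vector_space_axioms
  have R': "R' \<in> tspace sE E sE E"
    using \<open>quasitriangular sE E (\<circ>) id \<Delta>E \<epsilon>E R'\<close> by (simp add: quasitriangular_def Let_def)
  obtain B where B: "H.A.independent B" "H.A.span B = UNIV" "card B = H.A.dim (UNIV :: 'a set)"
    using H.A.basis_exists[of UNIV] by (metis top.extremum_uniqueI)
  have finB: "finite B" by (rule H.galois_finite_basis) fact+
  obtain P where P: "P \<subseteq> R_left sE E R'" "E.H.independent P" "R_left sE E R' \<subseteq> E.H.span P"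
    "card P = E.H.dim (R_left sE E R')" by (rule E.H.basis_exists)
  have PE: "P \<subseteq> End_H UNIV sA act"
    using P(1) R_left_subset[OF vsE subE R'] \<open>E = End_H UNIV sA act\<close> by blast
  \<comment> \<open>Stated for finite subsets because infinite sets have cardinality \<open>0\<close> by convention; the bound
    itself shows that \<open>P\<close> is finite.\<close>
  have upper: "card Q \<le> card B" if Q: "finite Q" "Q \<subseteq> P" for Q
  proof (rule H.card_independent_End_H_le[OF \<open>galois sH UNIV sA act\<close> finB B(1,2) Q(1)])
    show "Q \<subseteq> End_H UNIV sA act" using Q(2) PE by (rule order_trans)
    show "\<not> module.dependent (fun_scale sA) Q"
      using E.H.independent_mono[OF P(2) Q(2)] unfolding \<open>sE = fun_scale sA\<close> .
  qed
  have finP: "finite P"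
  proof (rule ccontr)
    assume "infinite P"
    then obtain Q where "Q \<subseteq> P" "finite Q" "card Q = Suc (card B)"
      using infinite_arbitrarily_large by blast
    with upper[of Q] show False by simp
  qed
  obtain Y q where Y: "finite Y" "Y \<subseteq> E" "\<And>y. y \<in> Y \<Longrightarrow> q y \<in> R_left sE E R' \<inter> E"
    "R' = (\<Sum>y\<in>Y. tpure sE E sE E (q y) y)"
    by (rule tensor_expansion_R_left[OF vsE subE R']) blast
  \<comment> \<open>The correspondence for \<open>R = 1 \<otimes> 1\<close> expresses right multiplication by \<open>a\<close> through the left factors of \<open>R'\<close>.\<close>
  have opposite: "b * a = (\<Sum>y\<in>Y. y a * q y b)" for a b
  proof -
    have bilH: "bilinear_on sH UNIV sH UNIV sA (\<lambda>x y. act y b * act x a)"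
      by (intro bilinear_onI linear_on_compose[OF H.act_linear(1) _ H.mult_linear(1)]
        linear_on_compose[OF H.act_linear(1) _ H.mult_linear(2)]) auto
    have bilE: "bilinear_on sE E sE E sA (\<lambda>x y. y a * x b)"
      by (intro bilinear_onI linear_on_compose[OF E.act_linear(1) _ H.mult_linear(1)]
        linear_on_compose[OF E.act_linear(1) _ H.mult_linear(2)]) auto
    have "b * a = tlift sH UNIV sH UNIV (\<lambda>x y. act y b * act x a) R"
      unfolding \<open>R = tpure sH UNIV sH UNIV 1 1\<close>
      by (subst tlift_tpure[OF vsA bilH]) (simp_all add: H.act_unit)
    also have "\<dots> = tlift sE E sE E (\<lambda>x y. y a * x b) R'"
      using \<open>corresponding sH UNIV act R sE E (\<lambda>\<phi> a. \<phi> a) R'\<close> by (simp add: corresponding_def)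
    also have "\<dots> = (\<Sum>y\<in>Y. y a * q y b)"
      unfolding Y(4) by (rule tlift_sum_set[OF vsA bilE]) (use Y in auto)
    finally show ?thesis .
  qed
  have "card B \<le> card P"
  proof (rule central_simple_card_le[OF H.A.algebra_on_axioms \<open>central_simple sA\<close> finB B(1,2) finP])
    fix a
    have "q y \<in> module.span (fun_scale sA) P" if "y \<in> Y" for y
      using subsetD[OF P(3)] Y(3)[OF that] unfolding \<open>sE = fun_scale sA\<close> by simp
    thus "\<exists>(Y :: ('a \<Rightarrow> 'a) set) y q. finite Y \<and> (\<forall>i\<in>Y. q i \<in> module.span (fun_scale sA) P) \<and>
      (\<forall>b. b * a = (\<Sum>i\<in>Y. y i * q i b))"
      by (intro exI[of _ Y] exI[of _ "\<lambda>y. y a"] exI[of _ q] conjI ballI allI Y(1) opposite)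
  qed
  with upper[OF finP order_refl] show ?thesis
    using P(4) B(3) by (simp add: qt_rank_def)
qed

end
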